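(* Let $\mathcal{H}$ be an infinite dimensional separable complex Hilbert space and let $\{f_i\}_{i\ge 1}$ be a frame in a closed subspace $\mathcal{K}\subseteq\mathcal{H}$. The following are equivalent: (i) There is a Parseval frame $\{x_i\}_{i\ge1}$ in a closed subspace $\mathcal{L}\subseteq\mathcal{H}$ such that $\sum_{i=1}^\infty\|f_i-x_i\|^2<\infty$. (ii) The canonical Parseval frame $\{u_i\}_{i\ge1}$ associated to $\{f_i\}$ satisfies $\sum_{i=1}^\infty\|f_i-u_i\|^2<\infty$.
   Context: A frame in a closed subspace $\mathcal{K}\subseteq\mathcal{H}$ is a sequence $\{f_i\}_{i\ge1}$ of vectors in $\mathcal{K}$ for which there are constants $A,B>0$ with $A\|f\|^2\le\sum_{i=1}^\infty|\langle f,f_i\rangle|^2\le B\|f\|^2$ for all $f\in\mathcal{K}$; it is a Parseval frame if one can take $A=B=1$. The synthesis operator of $\{f_i\}$ is the bounded operator $F:\ell^2\to\mathcal{H}$ with $F(e_i)=f_i$, where $\{e_i\}$ is the standard basis of $\ell^2=\ell^2(\mathbb{N})$; it has closed range $\mathcal{K}$. The synthesis operator of a Parseval frame is a partial isometry. Let $F=U|F|$ be the polar decomposition ($|F|=(F^*F)^{1/2}$, and $U$ is the unique partial isometry with $F=U|F|$ and $\ker(U)=\ker(F)$). The canonical Parseval frame associated to $\{f_i\}$ is $\{u_i\}=\{Ue_i\}$. *)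

theory Defs
  imports "HOL-Analysis.Analysis"
begin

section \<open>Complex inner product spaces and Hilbert spaces\<close>

text \<open>
  The library only has real inner product spaces. A complex inner product space is one whose
  underlying real inner product is the real part of a complex inner product; in particular the
  norm and the topology are those of the library, with \<open>norm x = sqrt (Re (cinner x x))\<close>.
  The complex inner product is linear in its first argument.
\<close>

class complex_inner = real_inner +
  fixes scaleC :: "complex \<Rightarrow> 'a \<Rightarrow> 'a"  (infixr "*\<^sub>C" 75)
    and cinner :: "'a \<Rightarrow> 'a \<Rightarrow> complex"
  assumes scaleC_add_right: "a *\<^sub>C (x + y) = a *\<^sub>C x + a *\<^sub>C y"
    and scaleC_add_left: "(a + b) *\<^sub>C x = a *\<^sub>C x + b *\<^sub>C x"
    and scaleC_scaleC: "a *\<^sub>C (b *\<^sub>C x) = (a * b) *\<^sub>C x"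
    and scaleC_of_real: "complex_of_real r *\<^sub>C x = r *\<^sub>R x"
    and cinner_commute: "cinner x y = cnj (cinner y x)"
    and cinner_add_left: "cinner (x + y) z = cinner x z + cinner y z"
    and cinner_scaleC_left: "cinner (a *\<^sub>C x) y = a * cinner x y"
    and inner_eq_Re_cinner: "inner x y = Re (cinner x y)"

class complex_hilbert = complex_inner + complete_space

subclass (in complex_hilbert) banach ..

lemma cinner_self: "cinner x x = complex_of_real ((norm x)\<^sup>2)" for x :: "'a::complex_inner"
proof (rule complex_eqI)
  show "Re (cinner x x) = Re (complex_of_real ((norm x)\<^sup>2))"
    by (simp add: power2_norm_eq_inner inner_eq_Re_cinner)
  have "Im (cinner x x) = - Im (cinner x x)"
    using arg_cong[OF cinner_commute[of x x], of Im] by simp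
  then show "Im (cinner x x) = Im (complex_of_real ((norm x)\<^sup>2))"
    by simp
qed

global_interpretation complex_vector: vector_space "scaleC :: complex \<Rightarrow> 'a \<Rightarrow> 'a::complex_inner"
  defines csubspace = complex_vector.subspace
    and cspan = complex_vector.span
proof unfold_locales
  show "1 *\<^sub>C x = x" for x :: 'a
    using scaleC_of_real[of 1 x] by simp
qed (auto simp: scaleC_add_right scaleC_add_left scaleC_scaleC)

definition closed_csubspace :: "'a::complex_inner set \<Rightarrow> bool" where
  "closed_csubspace K \<longleftrightarrow> csubspace K \<and> closed K"

section \<open>Bounded operators and the polar decomposition\<close>

definition bounded_clinear :: "('a::complex_inner \<Rightarrow> 'b::complex_inner) \<Rightarrow> bool" where
  "bounded_clinear T \<longleftrightarrow> bounded_linear T \<and> (\<forall>c x. T (c *\<^sub>C x) = c *\<^sub>C T x)"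

definition cadjoint :: "('a::complex_inner \<Rightarrow> 'b::complex_inner) \<Rightarrow> 'b \<Rightarrow> 'a" where
  "cadjoint T = (THE S. \<forall>x y. cinner (T x) y = cinner x (S y))"

definition positive_operator :: "('a::complex_inner \<Rightarrow> 'a) \<Rightarrow> bool" where
  "positive_operator T \<longleftrightarrow>
     bounded_clinear T \<and> (\<forall>x. cinner (T x) x \<in> \<real> \<and> 0 \<le> Re (cinner (T x) x))"

definition sqrt_operator :: "('a::complex_inner \<Rightarrow> 'a) \<Rightarrow> 'a \<Rightarrow> 'a" where
  "sqrt_operator T = (THE S. positive_operator S \<and> S \<circ> S = T)"

definition abs_operator :: "('a::complex_inner \<Rightarrow> 'b::complex_inner) \<Rightarrow> 'a \<Rightarrow> 'a" where
  "abs_operator T = sqrt_operator (cadjoint T \<circ> T)"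

definition kernel :: "('a::complex_inner \<Rightarrow> 'b::complex_inner) \<Rightarrow> 'a set" where
  "kernel T = {x. T x = 0}"

text \<open>A partial isometry is an operator that is isometric on the orthogonal complement of its kernel.\<close>

definition partial_isometry :: "('a::complex_inner \<Rightarrow> 'b::complex_inner) \<Rightarrow> bool" where
  "partial_isometry U \<longleftrightarrow>
     bounded_clinear U \<and> (\<forall>x. (\<forall>z\<in>kernel U. cinner x z = 0) \<longrightarrow> norm (U x) = norm x)"

definition polar_isometry :: "('a::complex_inner \<Rightarrow> 'b::complex_inner) \<Rightarrow> 'a \<Rightarrow> 'b" where
  "polar_isometry T =
     (THE U. partial_isometry U \<and> T = U \<circ> abs_operator T \<and> kernel U = kernel T)"

section \<open>The sequence space $\ell^2$\<close>

typedef ell2 = "{x :: nat \<Rightarrow> complex. summable (\<lambda>n. (cmod (x n))\<^sup>2)}"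
  morphisms ell2_nth Abs_ell2
  by (rule exI[of _ "\<lambda>_. 0"]) simp

setup_lifting type_definition_ell2

lemma ell2_summable: "summable (\<lambda>n. (cmod (ell2_nth x n))\<^sup>2)"
  using ell2_nth[of x] by simp

lemma square_summable_add:
  fixes x y :: "nat \<Rightarrow> complex"
  assumes "summable (\<lambda>n. (cmod (x n))\<^sup>2)" "summable (\<lambda>n. (cmod (y n))\<^sup>2)"
  shows "summable (\<lambda>n. (cmod (x n + y n))\<^sup>2)"
proof (rule summable_comparison_test')
  show "summable (\<lambda>n. 2 * (cmod (x n))\<^sup>2 + 2 * (cmod (y n))\<^sup>2)"
    using assms by (intro summable_add summable_mult)
  fix n :: nat
  have "(cmod (x n + y n))\<^sup>2 \<le> (cmod (x n) + cmod (y n))\<^sup>2"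
    by (intro power_mono norm_triangle_ineq) simp
  also have "\<dots> \<le> 2 * (cmod (x n))\<^sup>2 + 2 * (cmod (y n))\<^sup>2"
    using sum_squares_bound[of "cmod (x n)" "cmod (y n)"] by (simp add: power2_sum)
  finally show "norm ((cmod (x n + y n))\<^sup>2) \<le> 2 * (cmod (x n))\<^sup>2 + 2 * (cmod (y n))\<^sup>2"
    by simp
qed

lemma square_summable_scale:
  fixes x :: "nat \<Rightarrow> complex"
  assumes "summable (\<lambda>n. (cmod (x n))\<^sup>2)"
  shows "summable (\<lambda>n. (cmod (c * x n))\<^sup>2)"
  using summable_mult[OF assms, of "(cmod c)\<^sup>2"] by (simp add: norm_mult power_mult_distrib)

lemma square_summable_mult:
  fixes x y :: "nat \<Rightarrow> complex"
  assumes "summable (\<lambda>n. (cmod (x n))\<^sup>2)" "summable (\<lambda>n. (cmod (y n))\<^sup>2)"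
  shows "summable (\<lambda>n. x n * cnj (y n))"
proof (rule summable_comparison_test')
  show "summable (\<lambda>n. (cmod (x n))\<^sup>2 + (cmod (y n))\<^sup>2)"
    using assms by (intro summable_add)
  fix n :: nat
  have "0 \<le> cmod (x n) * cmod (y n)" by simp
  then have "cmod (x n) * cmod (y n) \<le> (cmod (x n))\<^sup>2 + (cmod (y n))\<^sup>2"
    using sum_squares_bound[of "cmod (x n)" "cmod (y n)"] by linarith
  then show "norm (x n * cnj (y n)) \<le> (cmod (x n))\<^sup>2 + (cmod (y n))\<^sup>2"
    by (simp add: norm_mult)
qed

lemma ell2_eqI: "(\<And>n. ell2_nth x n = ell2_nth y n) \<Longrightarrow> x = y"
  by (metis ell2_nth_inject ext)

lemmas ell2_mult_summable = square_summable_mult[OF ell2_summable ell2_summable]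

instantiation ell2 :: complex_inner
begin

lift_definition zero_ell2 :: ell2 is "\<lambda>_. 0" by simp

lift_definition plus_ell2 :: "ell2 \<Rightarrow> ell2 \<Rightarrow> ell2" is "\<lambda>x y n. x n + y n"
  by (simp add: square_summable_add)

lift_definition uminus_ell2 :: "ell2 \<Rightarrow> ell2" is "\<lambda>x n. - x n" by simp

lift_definition minus_ell2 :: "ell2 \<Rightarrow> ell2 \<Rightarrow> ell2" is "\<lambda>x y n. x n - y n"
  subgoal for x y using square_summable_add[of x "\<lambda>n. - y n"] by simp
  done

lift_definition scaleC_ell2 :: "complex \<Rightarrow> ell2 \<Rightarrow> ell2" is "\<lambda>c x n. c * x n"
  by (simp add: square_summable_scale)

definition scaleR_ell2 :: "real \<Rightarrow> ell2 \<Rightarrow> ell2" where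
  "scaleR_ell2 r x = complex_of_real r *\<^sub>C x"

definition cinner_ell2 :: "ell2 \<Rightarrow> ell2 \<Rightarrow> complex" where
  "cinner_ell2 x y = (\<Sum>n. ell2_nth x n * cnj (ell2_nth y n))"

definition inner_ell2 :: "ell2 \<Rightarrow> ell2 \<Rightarrow> real" where
  "inner_ell2 x y = Re (cinner x y)"

definition norm_ell2 :: "ell2 \<Rightarrow> real" where
  "norm_ell2 x = sqrt (inner x x)"

definition sgn_ell2 :: "ell2 \<Rightarrow> ell2" where
  "sgn_ell2 x = scaleR (inverse (norm x)) x"

definition dist_ell2 :: "ell2 \<Rightarrow> ell2 \<Rightarrow> real" where
  "dist_ell2 x y = norm (x - y)"

definition uniformity_ell2 :: "(ell2 \<times> ell2) filter" where
  "uniformity_ell2 = (INF e\<in>{0<..}. principal {(x, y). dist x y < e})"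

definition open_ell2 :: "ell2 set \<Rightarrow> bool" where
  "open_ell2 U \<longleftrightarrow> (\<forall>x\<in>U. \<forall>\<^sub>F (x', y) in uniformity. x' = x \<longrightarrow> y \<in> U)"

lemmas ell2_nth_simps = zero_ell2.rep_eq plus_ell2.rep_eq uminus_ell2.rep_eq
  minus_ell2.rep_eq scaleC_ell2.rep_eq

lemma inner_self_ell2: "inner x x = (\<Sum>n. (cmod (ell2_nth x n))\<^sup>2)" for x :: ell2
proof -
  have "cinner x x = (\<Sum>n. complex_of_real ((cmod (ell2_nth x n))\<^sup>2))"
    unfolding cinner_ell2_def by (simp only: complex_norm_square)
  also have "\<dots> = complex_of_real (\<Sum>n. (cmod (ell2_nth x n))\<^sup>2)"
    by (rule suminf_of_real[OF ell2_summable, symmetric])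
  finally show ?thesis by (simp add: inner_ell2_def)
qed

lemma cinner_ell2_commute: "cinner x y = cnj (cinner y x)" for x y :: ell2
proof -
  have "(\<lambda>n. ell2_nth y n * cnj (ell2_nth x n)) sums cinner y x"
    unfolding cinner_ell2_def by (intro summable_sums ell2_mult_summable)
  then have "(\<lambda>n. cnj (ell2_nth y n * cnj (ell2_nth x n))) sums cnj (cinner y x)"
    by (simp only: sums_cnj)
  then have "(\<lambda>n. ell2_nth x n * cnj (ell2_nth y n)) sums cnj (cinner y x)"
    by (simp add: mult.commute)
  then show ?thesis
    unfolding cinner_ell2_def[of x y] by (rule sums_unique[symmetric])
qed

lemma cinner_ell2_add: "cinner (x + y) z = cinner x z + cinner y z" for x y z :: ell2
  unfolding cinner_ell2_def
  by (simp add: ell2_nth_simps distrib_right suminf_add[OF ell2_mult_summable ell2_mult_summable])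

lemma cinner_ell2_scale: "cinner (a *\<^sub>C x) y = a * cinner x y" for x y :: ell2
  unfolding cinner_ell2_def
  by (simp add: ell2_nth_simps mult.assoc suminf_mult[OF ell2_mult_summable])

instance
proof
  fix x y z :: ell2 and r s :: real and a b :: complex
  show "x + y + z = x + (y + z)" "x + y = y + x" "0 + x = x" "- x + x = 0" "x - y = x + - y"
    by (auto intro!: ell2_eqI simp: ell2_nth_simps)
  show "r *\<^sub>R (x + y) = r *\<^sub>R x + r *\<^sub>R y" "(r + s) *\<^sub>R x = r *\<^sub>R x + s *\<^sub>R x"
    "r *\<^sub>R s *\<^sub>R x = (r * s) *\<^sub>R x" "1 *\<^sub>R x = x"
    by (auto intro!: ell2_eqI simp: scaleR_ell2_def ell2_nth_simps algebra_simps)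
  show "a *\<^sub>C (x + y) = a *\<^sub>C x + a *\<^sub>C y" "(a + b) *\<^sub>C x = a *\<^sub>C x + b *\<^sub>C x"
    "a *\<^sub>C b *\<^sub>C x = (a * b) *\<^sub>C x"
    by (auto intro!: ell2_eqI simp: ell2_nth_simps algebra_simps)
  show "complex_of_real r *\<^sub>C x = r *\<^sub>R x"
    by (simp add: scaleR_ell2_def)
  show "sgn x = scaleR (inverse (norm x)) x" by (rule sgn_ell2_def)
  show "dist x y = norm (x - y)" by (rule dist_ell2_def)
  show "uniformity = (INF e\<in>{0<..}. principal {(x :: ell2, y). dist x y < e})"
    by (rule uniformity_ell2_def)
  show "open U \<longleftrightarrow> (\<forall>x\<in>U. \<forall>\<^sub>F (x', y) in uniformity. x' = x \<longrightarrow> y \<in> U)" for U :: "ell2 set"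
    by (rule open_ell2_def)
  show "cinner x y = cnj (cinner y x)" by (rule cinner_ell2_commute)
  show "cinner (x + y) z = cinner x z + cinner y z" by (rule cinner_ell2_add)
  show "cinner (a *\<^sub>C x) y = a * cinner x y" by (rule cinner_ell2_scale)
  show "inner x y = Re (cinner x y)" by (rule inner_ell2_def)
  show "norm x = sqrt (inner x x)" by (rule norm_ell2_def)
  show "inner x y = inner y x"
    unfolding inner_ell2_def by (subst cinner_ell2_commute) simp
  show "inner (x + y) z = inner x z + inner y z"
    by (simp add: inner_ell2_def cinner_ell2_add)
  show "inner (r *\<^sub>R x) y = r * inner x y"
    by (simp add: inner_ell2_def scaleR_ell2_def cinner_ell2_scale)
  show "0 \<le> inner x x"
    by (simp add: inner_self_ell2 suminf_nonneg ell2_summable)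
  show "inner x x = 0 \<longleftrightarrow> x = 0"
    by (auto simp: inner_self_ell2 suminf_eq_zero_iff ell2_summable ell2_nth_simps intro!: ell2_eqI)
qed

end

lemma power2_norm_ell2: "(norm x)\<^sup>2 = (\<Sum>n. (cmod (ell2_nth x n))\<^sup>2)" for x :: ell2
  by (simp add: power2_norm_eq_inner inner_self_ell2)

lemma sum_le_power2_norm_ell2:
  "finite A \<Longrightarrow> (\<Sum>n\<in>A. (cmod (ell2_nth x n))\<^sup>2) \<le> (norm x)\<^sup>2"
  unfolding power2_norm_ell2 by (intro sum_le_suminf ell2_summable) auto

lemma cmod_ell2_nth_le: "cmod (ell2_nth x n) \<le> norm x"
  by (rule power2_le_imp_le) (use sum_le_power2_norm_ell2[of "{n}" x] in simp_all)

instance ell2 :: complex_hilbert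
proof
  fix X :: "nat \<Rightarrow> ell2"
  assume "Cauchy X"
  have "Cauchy (\<lambda>k. ell2_nth (X k) n)" for n
  proof (rule CauchyI)
    fix e :: real assume "0 < e"
    then obtain M where M: "\<forall>i\<ge>M. \<forall>j\<ge>M. norm (X i - X j) < e"
      using \<open>Cauchy X\<close> CauchyD by blast
    show "\<exists>M. \<forall>i\<ge>M. \<forall>j\<ge>M. norm (ell2_nth (X i) n - ell2_nth (X j) n) < e"
    proof (intro exI[of _ M] allI impI)
      fix i j assume "M \<le> i" "M \<le> j"
      then have "norm (X i - X j) < e" using M by blast
      then show "norm (ell2_nth (X i) n - ell2_nth (X j) n) < e"
        using cmod_ell2_nth_le[of "X i - X j" n] by (simp add: minus_ell2.rep_eq)
    qed
  qed
  then have "\<exists>l. (\<lambda>k. ell2_nth (X k) n) \<longlonglongrightarrow> l" for n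
    by (simp add: Cauchy_convergent_iff convergent_def)
  then obtain l where l: "\<And>n. (\<lambda>k. ell2_nth (X k) n) \<longlonglongrightarrow> l n"
    by metis
  have bound: "(\<Sum>n<m. (cmod (ell2_nth (X i) n - l n))\<^sup>2) \<le> e\<^sup>2"
    if M: "\<forall>i\<ge>M. \<forall>j\<ge>M. norm (X i - X j) < e" and "M \<le> i" "0 < e" for e M i m
  proof (rule tendsto_upperbound)
    show "(\<lambda>j. \<Sum>n<m. (cmod (ell2_nth (X i) n - ell2_nth (X j) n))\<^sup>2)
        \<longlonglongrightarrow> (\<Sum>n<m. (cmod (ell2_nth (X i) n - l n))\<^sup>2)"
      by (intro tendsto_intros l)
    show "\<forall>\<^sub>F j in sequentially. (\<Sum>n<m. (cmod (ell2_nth (X i) n - ell2_nth (X j) n))\<^sup>2) \<le> e\<^sup>2"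
    proof (rule eventually_sequentiallyI[of M])
      fix j assume "M \<le> j"
      have "(\<Sum>n<m. (cmod (ell2_nth (X i) n - ell2_nth (X j) n))\<^sup>2) \<le> (norm (X i - X j))\<^sup>2"
        using sum_le_power2_norm_ell2[of "{..<m}" "X i - X j"] by (simp add: minus_ell2.rep_eq)
      also have "\<dots> \<le> e\<^sup>2"
        using M \<open>M \<le> i\<close> \<open>M \<le> j\<close> by (intro power_mono) (auto intro: less_imp_le)
      finally show "(\<Sum>n<m. (cmod (ell2_nth (X i) n - ell2_nth (X j) n))\<^sup>2) \<le> e\<^sup>2" .
    qed
  qed simp
  have diff_summable: "summable (\<lambda>n. (cmod (ell2_nth (X i) n - l n))\<^sup>2)"
    if M: "\<forall>i\<ge>M. \<forall>j\<ge>M. norm (X i - X j) < e" and "M \<le> i" "0 < e" for e M i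
    by (rule summableI_nonneg_bounded[where x = "e\<^sup>2"]) (use bound[OF that] in auto)
  obtain M where M: "\<forall>i\<ge>M. \<forall>j\<ge>M. norm (X i - X j) < 1"
    using \<open>Cauchy X\<close> CauchyD[of X 1] by auto
  have "summable (\<lambda>n. (cmod (l n))\<^sup>2)"
    using square_summable_add[OF ell2_summable[of "X M"], of "\<lambda>n. l n - ell2_nth (X M) n"]
      diff_summable[OF M, of M]
    by (simp add: norm_minus_commute)
  then have nth_l: "ell2_nth (Abs_ell2 l) = l"
    by (simp add: Abs_ell2_inverse)
  have "X \<longlonglongrightarrow> Abs_ell2 l"
  proof (rule LIMSEQ_I)
    fix r :: real assume "0 < r"
    then obtain N where N: "\<forall>i\<ge>N. \<forall>j\<ge>N. norm (X i - X j) < r / 2"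
      using \<open>Cauchy X\<close> CauchyD[of X "r / 2"] by auto
    show "\<exists>N. \<forall>i\<ge>N. norm (X i - Abs_ell2 l) < r"
    proof (intro exI[of _ N] allI impI)
      fix i assume "N \<le> i"
      have "(norm (X i - Abs_ell2 l))\<^sup>2 \<le> (r / 2)\<^sup>2"
        unfolding power2_norm_ell2 minus_ell2.rep_eq nth_l
        using \<open>0 < r\<close> \<open>N \<le> i\<close>
        by (intro suminf_le_const diff_summable[OF N] bound[OF N]) auto
      then have "norm (X i - Abs_ell2 l) \<le> r / 2"
        by (rule power2_le_imp_le) (use \<open>0 < r\<close> in simp)
      then show "norm (X i - Abs_ell2 l) < r"
        using \<open>0 < r\<close> by simp
    qed
  qed
  then show "convergent X"
    by (auto simp: convergent_def)
qed

lift_definition ell2_basis :: "nat \<Rightarrow> ell2" is "\<lambda>i n. if n = i then 1 else 0"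
  subgoal for i by (rule summable_finite[of "{i}"]) auto
  done

section \<open>Frames\<close>

text \<open>
  Sequences are indexed from \<open>0\<close>. The conjunct \<open>summable\<close> is needed because
  \<open>suminf\<close> of a divergent series is unspecified.
\<close>

definition frame_bounds :: "'a::complex_inner set \<Rightarrow> (nat \<Rightarrow> 'a) \<Rightarrow> real \<Rightarrow> real \<Rightarrow> bool" where
  "frame_bounds K f A B \<longleftrightarrow>
     (\<forall>g\<in>K. summable (\<lambda>i. (cmod (cinner g (f i)))\<^sup>2) \<and>
       A * (norm g)\<^sup>2 \<le> (\<Sum>i. (cmod (cinner g (f i)))\<^sup>2) \<and>
       (\<Sum>i. (cmod (cinner g (f i)))\<^sup>2) \<le> B * (norm g)\<^sup>2)"

definition frame_in :: "'a::complex_inner set \<Rightarrow> (nat \<Rightarrow> 'a) \<Rightarrow> bool" where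
  "frame_in K f \<longleftrightarrow> (\<forall>i. f i \<in> K) \<and> (\<exists>A>0. \<exists>B>0. frame_bounds K f A B)"

definition parseval_frame_in :: "'a::complex_inner set \<Rightarrow> (nat \<Rightarrow> 'a) \<Rightarrow> bool" where
  "parseval_frame_in K f \<longleftrightarrow> (\<forall>i. f i \<in> K) \<and> frame_bounds K f 1 1"

definition synthesis_operator :: "(nat \<Rightarrow> 'a::complex_inner) \<Rightarrow> ell2 \<Rightarrow> 'a" where
  "synthesis_operator f = (THE F. bounded_clinear F \<and> (\<forall>i. F (ell2_basis i) = f i))"

definition canonical_parseval_frame :: "(nat \<Rightarrow> 'a::complex_inner) \<Rightarrow> nat \<Rightarrow> 'a" where
  "canonical_parseval_frame f i = polar_isometry (synthesis_operator f) (ell2_basis i)"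

end

theory Submission
  imports Defs
begin

text \<open>
  Let \<open>F\<close> be the synthesis operator of the frame and \<open>F = U |F|\<close> its polar decomposition.
  Since \<open>f i - u i\<close> is the image of the \<open>i\<close>-th basis vector under \<open>F - U\<close>, square summability of
  the distances says that \<open>F - U\<close> is a Hilbert--Schmidt operator. The adjoint of a
  partial isometry is isometric on its range, so \<open>U\<close> sends the basis to a Parseval frame for its
  range (\<open>partial_isometry_parseval_frame\<close>); hence if \<open>F - U\<close> is Hilbert--Schmidt, then the
  \<open>u i\<close> are a Parseval frame as required.

  Conversely let \<open>X\<close> be the synthesis operator of any Parseval frame with \<open>F - X\<close>
  Hilbert--Schmidt. Put \<open>T = F\<^sup>* F\<close> and let \<open>P\<close> be the projection onto the orthogonal complement
  of the kernel of \<open>F\<close>. As \<open>X\<close> is a partial isometry (\<open>parseval_synthesis\<close>), \<open>Q = X\<^sup>* X\<close> is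
  idempotent, and \<open>T - Q = F\<^sup>* (F - X) + (F - X)\<^sup>* X\<close> is Hilbert--Schmidt. The Hilbert--Schmidt
  operators form a two-sided ideal, so \<open>T\<close> is almost idempotent:
  \<open>T - T\<^sup>2 = (T - Q) - Q (T - Q) - (T - Q) T\<close> is Hilbert--Schmidt. The lower frame bound
  makes \<open>T\<close> bounded below on the range of \<open>P\<close> (\<open>bounded_below_on_support\<close>), so
  \<open>T - T\<^sup>2 = T (P - T)\<close> forces \<open>P - T\<close> to be Hilbert--Schmidt. Finally
  \<open>T - P = (1 + |F|) (|F| - P)\<close>, so \<open>|F| - P\<close> and with it \<open>F - U = U (|F| - P)\<close> are
  Hilbert--Schmidt. This is \<open>hilbert_schmidt_polar_isometry\<close>.

  The remaining work shows that the objects exist. Adjoints come from the Riesz representation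
  theorem, and so from orthogonal projections. The square root \<open>|F|\<close> needs no spectral theorem:
  because \<open>F\<close> has closed range, \<open>T + (1 - P)\<close> is bounded below, and the square root of such an
  operator is found as the fixed point of a contraction (\<open>coercive_sqrt\<close>). Everything up to that point is
  real Hilbert space theory; complex linearity is recovered from the fact that the square root
  commutes with all bounded real-linear maps that commute with the given operator, among them
  multiplication by \<open>\<i>\<close>.
\<close>

section \<open>Orthogonal projections and adjoints in real Hilbert spaces\<close>

lemma exists_orthogonal_projection:
  fixes S :: "'a::{real_inner,banach} set"
  assumes S: "closed S" "subspace S"
  shows "\<exists>p\<in>S. \<forall>s\<in>S. inner (x - p) s = 0"
proof -
  define d where "d = infdist x S"
  have ne: "S \<noteq> {}" using S(2) subspace_0 by blast
  have d_le: "d \<le> norm (x - s)" if "s \<in> S" for s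
    unfolding d_def using infdist_le[OF that, of x] by (simp add: dist_norm)
  have d0: "0 \<le> d" unfolding d_def by (rule infdist_nonneg)
  have "\<exists>p\<in>S. norm (x - p) < d + 1 / real (Suc n)" for n
  proof (rule ccontr)
    assume "\<not> ?thesis"
    then have "d + 1 / real (Suc n) \<le> d"
      unfolding d_def infdist_notempty[OF ne] using ne
      by (intro cINF_greatest) (auto simp: dist_norm not_less)
    then show False by simp
  qed
  then obtain p where p: "\<And>n. p n \<in> S" "\<And>n. norm (x - p n) < d + 1 / real (Suc n)"
    by metis
  (* midpoints of S stay at distance at least d from x, so the parallelogram law
     forces a minimizing sequence to be Cauchy *)
  have parallelogram: "(norm (p m - p n))\<^sup>2 \<le> 2 * (norm (x - p m))\<^sup>2 + 2 * (norm (x - p n))\<^sup>2 - 4 * d\<^sup>2" for m n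
  proof -
    have "(1/2) *\<^sub>R (p m + p n) \<in> S"
      using p(1) S(2) by (intro subspace_mul subspace_add)
    then have "d\<^sup>2 \<le> (norm (x - (1/2) *\<^sub>R (p m + p n)))\<^sup>2"
      using d_le d0 by (intro power_mono) auto
    then show ?thesis
      by (simp add: power2_norm_eq_inner inner_diff inner_add inner_commute algebra_simps)
  qed
  have "Cauchy p"
  proof (rule CauchyI)
    fix e :: real assume "0 < e"
    have "(\<lambda>n. (d + 1 / real (Suc n))\<^sup>2) \<longlonglongrightarrow> (d + 0)\<^sup>2"
      by (intro tendsto_intros LIMSEQ_Suc[OF lim_1_over_n])
    then have "\<forall>\<^sub>F n in sequentially. (d + 1 / real (Suc n))\<^sup>2 < d\<^sup>2 + e\<^sup>2 / 4"
      by (rule order_tendstoD(2)) (use \<open>0 < e\<close> in simp)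
    then obtain N where N: "\<And>n. n \<ge> N \<Longrightarrow> (d + 1 / real (Suc n))\<^sup>2 < d\<^sup>2 + e\<^sup>2 / 4"
      by (auto simp: eventually_sequentially)
    have near: "(norm (x - p n))\<^sup>2 < d\<^sup>2 + e\<^sup>2 / 4" if "n \<ge> N" for n
      using power_mono[OF less_imp_le[OF p(2)[of n]], of 2] N[OF that] by simp
    have "norm (p m - p n) < e" if "m \<ge> N" "n \<ge> N" for m n
    proof (rule power2_less_imp_less)
      show "(norm (p m - p n))\<^sup>2 < e\<^sup>2"
        using parallelogram[of m n] near[OF that(1)] near[OF that(2)] by linarith
    qed (use \<open>0 < e\<close> in simp)
    then show "\<exists>M. \<forall>m\<ge>M. \<forall>n\<ge>M. norm (p m - p n) < e" by blast
  qed
  then obtain q where q: "p \<longlonglongrightarrow> q"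
    using Cauchy_convergent convergent_def by blast
  have qS: "q \<in> S"
    using closed_sequentially[OF S(1)] p(1) q by blast
  have "norm (x - q) \<le> d"
  proof (rule LIMSEQ_le)
    show "(\<lambda>n. norm (x - p n)) \<longlonglongrightarrow> norm (x - q)"
      by (intro tendsto_intros q)
    show "(\<lambda>n. d + 1 / real (Suc n)) \<longlonglongrightarrow> d"
      using tendsto_add[OF tendsto_const LIMSEQ_Suc[OF lim_1_over_n], of d] by simp
    show "\<exists>N. \<forall>n\<ge>N. norm (x - p n) \<le> d + 1 / real (Suc n)"
      using p(2) less_imp_le by blast
  qed
  then have q_min: "norm (x - q) \<le> norm (x - s)" if "s \<in> S" for s
    using d_le[OF that] by linarith
  have "inner (x - q) s = 0" if s: "s \<in> S" for s
  proof (cases "s = 0")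
    case False
    define t where "t = inner (x - q) s / (norm s)\<^sup>2"
    have "q + t *\<^sub>R s \<in> S"
      using qS s S(2) by (intro subspace_add subspace_mul)
    then have "(norm (x - q))\<^sup>2 \<le> (norm ((x - q) - t *\<^sub>R s))\<^sup>2"
      using q_min by (intro power_mono) (auto simp: algebra_simps)
    also have "\<dots> = (norm (x - q))\<^sup>2 - 2 * t * inner (x - q) s + t\<^sup>2 * (norm s)\<^sup>2"
    proof -
      have "(norm (v - t *\<^sub>R s))\<^sup>2 = (norm v)\<^sup>2 - 2 * t * inner v s + t\<^sup>2 * (norm s)\<^sup>2" for v
        unfolding power2_norm_eq_inner power2_eq_square[of t]
        by (simp add: inner_diff inner_commute[of s v] algebra_simps)
      then show ?thesis .
    qed
    also have "\<dots> = (norm (x - q))\<^sup>2 - (inner (x - q) s)\<^sup>2 / (norm s)\<^sup>2"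
      using False by (simp add: t_def power2_eq_square field_simps)
    finally show ?thesis using False by (simp add: divide_le_0_iff)
  qed simp
  then show ?thesis using qS by blast
qed

definition orthogonal_projection :: "'a::real_inner set \<Rightarrow> 'a \<Rightarrow> 'a" where
  "orthogonal_projection S x = (SOME p. p \<in> S \<and> (\<forall>s\<in>S. inner (x - p) s = 0))"

definition selfadjoint :: "('a::real_inner \<Rightarrow> 'a) \<Rightarrow> bool" where
  "selfadjoint T \<longleftrightarrow> (\<forall>x y. inner (T x) y = inner x (T y))"

lemma selfadjointD: "selfadjoint T \<Longrightarrow> inner (T x) y = inner x (T y)"
  by (simp add: selfadjoint_def)

context
  fixes S :: "'a::{real_inner,banach} set"
  assumes S: "closed S" "subspace S"
begin

lemma orthogonal_projection_in: "orthogonal_projection S x \<in> S"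
  and orthogonal_projection_residual: "s \<in> S \<Longrightarrow> inner (x - orthogonal_projection S x) s = 0"
proof -
  have "\<exists>p. p \<in> S \<and> (\<forall>s\<in>S. inner (x - p) s = 0)"
    using exists_orthogonal_projection[OF S] by blast
  from someI_ex[OF this]
  show "orthogonal_projection S x \<in> S"
    "s \<in> S \<Longrightarrow> inner (x - orthogonal_projection S x) s = 0"
    by (auto simp: orthogonal_projection_def)
qed

lemma orthogonal_projection_eqI:
  assumes "p \<in> S" "\<And>s. s \<in> S \<Longrightarrow> inner (x - p) s = 0"
  shows "orthogonal_projection S x = p"
proof -
  let ?q = "orthogonal_projection S x"
  have "p - ?q \<in> S"
    using assms(1) orthogonal_projection_in subspace_diff[OF S(2)] by blast
  then have "inner (x - ?q) (p - ?q) - inner (x - p) (p - ?q) = 0"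
    using assms(2) orthogonal_projection_residual by simp
  then have "inner (p - ?q) (p - ?q) = 0"
    by (simp add: inner_diff_left)
  then show ?thesis by simp
qed

lemma orthogonal_projection_id: "s \<in> S \<Longrightarrow> orthogonal_projection S s = s"
  by (rule orthogonal_projection_eqI) simp_all

lemma selfadjoint_orthogonal_projection: "selfadjoint (orthogonal_projection S)"
  unfolding selfadjoint_def
proof (intro allI)
  fix x y
  let ?P = "orthogonal_projection S"
  have "inner (x - ?P x) (?P y) = 0" "inner (y - ?P y) (?P x) = 0"
    by (rule orthogonal_projection_residual orthogonal_projection_in)+
  then show "inner (?P x) y = inner x (?P y)"
    unfolding inner_diff_left by (simp add: inner_commute[of y] inner_commute[of "?P y"])
qed

lemma norm_orthogonal_projection_le: "norm (orthogonal_projection S x) \<le> norm x"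
proof -
  let ?p = "orthogonal_projection S x"
  have "(norm ?p)\<^sup>2 = inner x ?p"
    using orthogonal_projection_residual[OF orthogonal_projection_in, of x x]
    by (simp add: inner_diff_left power2_norm_eq_inner)
  also have "\<dots> \<le> norm x * norm ?p" by (rule norm_cauchy_schwarz)
  finally have "norm ?p * norm ?p \<le> norm x * norm ?p"
    by (simp add: power2_eq_square)
  then show ?thesis
    by (metis mult_le_cancel_right norm_ge_zero norm_le_zero_iff order.trans linorder_not_le)
qed

lemma bounded_linear_orthogonal_projection: "bounded_linear (orthogonal_projection S)"
proof (rule bounded_linear_intro[where K=1])
  let ?P = "orthogonal_projection S"
  fix x y and r :: real
  show "?P (x + y) = ?P x + ?P y"
  proof (rule orthogonal_projection_eqI)
    show "?P x + ?P y \<in> S" by (intro subspace_add S orthogonal_projection_in)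
    show "inner (x + y - (?P x + ?P y)) s = 0" if "s \<in> S" for s
      using orthogonal_projection_residual[OF that, of x] orthogonal_projection_residual[OF that, of y]
      by (simp add: inner_diff_left inner_add_left)
  qed
  show "?P (r *\<^sub>R x) = r *\<^sub>R ?P x"
  proof (rule orthogonal_projection_eqI)
    show "r *\<^sub>R ?P x \<in> S" by (intro subspace_mul S orthogonal_projection_in)
    show "inner (r *\<^sub>R x - r *\<^sub>R ?P x) s = 0" if "s \<in> S" for s
      using orthogonal_projection_residual[OF that, of x] by (simp add: inner_diff_left)
  qed
  show "norm (?P x) \<le> norm x * 1" by (simp add: norm_orthogonal_projection_le)
qed

text \<open>
  A linear map that preserves a closed subspace and its orthogonal complement respects the
  orthogonal decomposition of every vector.
\<close>

lemma orthogonal_projection_commutes: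
  assumes "linear C" "\<And>s. s \<in> S \<Longrightarrow> C s \<in> S"
    and "\<And>z s. (\<And>s. s \<in> S \<Longrightarrow> inner z s = 0) \<Longrightarrow> s \<in> S \<Longrightarrow> inner (C z) s = 0"
  shows "orthogonal_projection S (C x) = C (orthogonal_projection S x)"
proof (rule orthogonal_projection_eqI)
  show "C (orthogonal_projection S x) \<in> S"
    by (intro assms(2) orthogonal_projection_in)
  show "inner (C x - C (orthogonal_projection S x)) s = 0" if "s \<in> S" for s
    using assms(3)[OF orthogonal_projection_residual that, of x] linear_diff[OF assms(1)] by simp
qed

end

text \<open>
  A nonzero functional is represented by a multiple of the residual of a vector outside its
  kernel: that residual spans the orthogonal complement of the kernel.
\<close>

lemma riesz_representation:
  fixes \<phi> :: "'a::{real_inner,banach} \<Rightarrow> real"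
  assumes "bounded_linear \<phi>"
  shows "\<exists>z. \<forall>x. \<phi> x = inner x z"
proof (cases "\<forall>x. \<phi> x = 0")
  case True
  then show ?thesis by (intro exI[of _ 0]) simp
next
  case False
  interpret bounded_linear \<phi> by fact
  define N where "N = {x. \<phi> x = 0}"
  have N: "closed N" "subspace N"
    unfolding N_def
     apply (rule closed_Collect_eq[OF linear_continuous_on[OF assms] continuous_on_const])
    by (auto simp: subspace_def add scale zero)
  from False obtain x where x: "\<phi> x \<noteq> 0" by blast
  define w where "w = x - orthogonal_projection N x"
  have "\<phi> (orthogonal_projection N x) = 0"
    using orthogonal_projection_in[OF N] N_def by blast
  then have w: "\<phi> w \<noteq> 0"
    using x by (simp add: w_def diff)
  then have "w \<noteq> 0" using zero by metis
  have "\<phi> y = inner y ((\<phi> w / (norm w)\<^sup>2) *\<^sub>R w)" for y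
  proof -
    have "y - (\<phi> y / \<phi> w) *\<^sub>R w \<in> N"
      using w by (simp add: N_def diff scale)
    from orthogonal_projection_residual[OF N this, of x]
    have "inner y w = \<phi> y / \<phi> w * (norm w)\<^sup>2"
      by (simp add: w_def[symmetric] inner_diff_right power2_norm_eq_inner inner_commute)
    then show ?thesis using w \<open>w \<noteq> 0\<close> by simp
  qed
  then show ?thesis by blast
qed

text \<open>
  The constant \<open>adjoint\<close> is defined by a choice; the Riesz representation theorem shows that there
  is something to choose, in infinite dimension as well.
\<close>

lemma inner_adjoint:
  fixes F :: "'a::{real_inner,banach} \<Rightarrow> 'b::real_inner"
  assumes "bounded_linear F"
  shows "inner (F x) y = inner x (adjoint F y)"
proof -
  have "\<exists>z. \<forall>x. inner (F x) y = inner x z" for y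
    by (rule riesz_representation[OF bounded_linear_compose[OF bounded_linear_inner_left assms]])
  then obtain G where "\<forall>x y. inner (F x) y = inner x (G y)" by metis
  moreover from adjoint_unique[OF this] have "adjoint F = G" .
  ultimately show ?thesis by simp
qed

lemma inner_adjoint_left:
  fixes F :: "'a::{real_inner,banach} \<Rightarrow> 'b::real_inner"
  assumes "bounded_linear F"
  shows "inner (adjoint F y) x = inner y (F x)"
  by (metis inner_adjoint[OF assms] inner_commute)

lemma bounded_linear_adjoint:
  fixes F :: "'a::{real_inner,banach} \<Rightarrow> 'b::real_inner"
  assumes "bounded_linear F"
  shows "bounded_linear (adjoint F)"
proof -
  interpret bounded_linear F by fact
  obtain K where K: "0 \<le> K" "\<And>x. norm (F x) \<le> norm x * K"
    using nonneg_bounded by blast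
  show ?thesis
  proof (rule bounded_linear_intro[where K=K])
    fix x y and r :: real
    show "adjoint F (x + y) = adjoint F x + adjoint F y"
      by (rule vector_eq_ldot[THEN iffD1])
        (simp add: inner_adjoint[OF assms, symmetric] inner_add_right)
    show "adjoint F (r *\<^sub>R x) = r *\<^sub>R adjoint F x"
      by (rule vector_eq_ldot[THEN iffD1])
        (simp add: inner_adjoint[OF assms, symmetric])
    have "norm (adjoint F x) * norm (adjoint F x) = inner (F (adjoint F x)) x"
      by (simp add: inner_adjoint[OF assms] power2_norm_eq_inner flip: power2_eq_square)
    also have "\<dots> \<le> norm (F (adjoint F x)) * norm x"
      by (rule norm_cauchy_schwarz)
    also have "\<dots> \<le> norm (adjoint F x) * K * norm x"
      by (intro mult_right_mono K) simp
    finally have "norm (adjoint F x) * norm (adjoint F x) \<le> norm (adjoint F x) * (norm x * K)"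
      by (simp add: mult_ac)
    then show "norm (adjoint F x) \<le> norm x * K"
      using K(1) by (cases "adjoint F x = 0") auto
  qed
qed

lemma adjoint_contraction:
  fixes G :: "'a::{real_inner,banach} \<Rightarrow> 'b::real_inner"
  assumes G: "bounded_linear G" "\<And>x. norm (G x) \<le> norm x"
  shows "norm (adjoint G y) \<le> norm y"
proof (cases "adjoint G y = 0")
  case False
  have "norm (adjoint G y) * norm (adjoint G y) = inner (G (adjoint G y)) y"
    by (simp add: inner_adjoint[OF G(1)] power2_norm_eq_inner flip: power2_eq_square)
  also have "\<dots> \<le> norm (G (adjoint G y)) * norm y" by (rule norm_cauchy_schwarz)
  also have "\<dots> \<le> norm (adjoint G y) * norm y" by (intro mult_right_mono G) simp
  finally show ?thesis using False by simp
qed simp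

text \<open>
  Both partial isometries and synthesis operators of Parseval frames are handled by this remark:
  if \<open>G\<close> preserves the norm of \<open>x\<close>, then \<open>x\<close> and \<open>H (G x)\<close> have inner product
  \<open>\<parallel>x\<parallel>\<^sup>2\<close> although the norm of \<open>H (G x)\<close> is at most \<open>\<parallel>x\<parallel>\<close>, so they agree by the equality case of the
  Cauchy--Schwarz inequality.
\<close>

lemma contraction_inverts_isometric_part:
  fixes G :: "'a::real_inner \<Rightarrow> 'b::real_inner"
  assumes adj: "\<And>x y. inner (G x) y = inner x (H y)"
    and H: "\<And>y. norm (H y) \<le> norm y" and iso: "norm (G x) = norm x"
  shows "H (G x) = x"
proof -
  have "(norm (H (G x) - x))\<^sup>2 = (norm (H (G x)))\<^sup>2 - 2 * (norm (G x))\<^sup>2 + (norm x)\<^sup>2"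
    by (simp add: power2_norm_eq_inner inner_diff adj[of x "G x"] inner_commute)
  also have "\<dots> \<le> (norm (G x))\<^sup>2 - 2 * (norm (G x))\<^sup>2 + (norm x)\<^sup>2"
    using H by (intro add_mono diff_mono power_mono) auto
  also have "\<dots> = 0" by (simp add: iso)
  finally show ?thesis by simp
qed

lemma subspace_closure:
  fixes S :: "'a::real_normed_vector set"
  assumes "subspace S"
  shows "subspace (closure S)"
proof (rule subspaceI)
  show "0 \<in> closure S" using subspace_0[OF assms] closure_subset by blast
  fix x y :: 'a and c :: real
  assume "x \<in> closure S"
  then obtain X where X: "\<And>n. X n \<in> S" "X \<longlonglongrightarrow> x" by (metis closure_sequential)
  show "x + y \<in> closure S" if "y \<in> closure S"
  proof -
    from that obtain Y where Y: "\<And>n. Y n \<in> S" "Y \<longlonglongrightarrow> y" by (metis closure_sequential)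
    show ?thesis unfolding closure_sequential
      using X Y assms by (intro exI[of _ "\<lambda>n. X n + Y n"]) (auto intro!: tendsto_add subspace_add)
  qed
  show "c *\<^sub>R x \<in> closure S" unfolding closure_sequential
    using X assms by (intro exI[of _ "\<lambda>n. c *\<^sub>R X n"]) (auto intro!: tendsto_scaleR subspace_mul)
qed

section \<open>Square roots of coercive operators\<close>

text \<open>
  Coercivity bounds the numerical range of \<open>W\<close> away from \<open>0\<close>, so a small step \<open>t\<close> makes \<open>1 - t W\<close>
  a strict contraction, also when \<open>W\<close> is not selfadjoint.
\<close>

lemma coercive_contraction:
  fixes W :: "'a::real_inner \<Rightarrow> 'a"
  assumes W: "bounded_linear W" and a: "0 < a" "\<And>x. a * (norm x)\<^sup>2 \<le> inner (W x) x"
  obtains t q where "0 < t" "0 \<le> q" "q < 1" "\<And>x. norm (x - t *\<^sub>R W x) \<le> q * norm x"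
proof -
  obtain K where K: "0 \<le> K" "\<And>x. norm (W x) \<le> norm x * K"
    using bounded_linear.nonneg_bounded[OF W] by blast
  (* the choice of t minimizes 1 - 2 t a + t^2 M^2, which bounds the square of the norm of 1 - t W;
     adding a to K makes M positive and the minimum nonnegative *)
  define M where "M = K + a"
  define t where "t = a / M\<^sup>2"
  define q where "q = sqrt (1 - a\<^sup>2 / M\<^sup>2)"
  have M: "0 < M" "a \<le> M" using K(1) a(1) by (auto simp: M_def)
  then have "a\<^sup>2 \<le> M\<^sup>2" using a(1) by (intro power_mono) auto
  then have q2: "0 \<le> 1 - a\<^sup>2 / M\<^sup>2" "1 - a\<^sup>2 / M\<^sup>2 < 1"
    using a(1) M by (auto simp: field_simps)
  have t: "0 < t" using a(1) M by (simp add: t_def)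
  have "norm (x - t *\<^sub>R W x) \<le> q * norm x" for x
  proof (rule power2_le_imp_le)
    have "norm (W x) \<le> M * norm x"
      using K(2)[of x] a(1) mult_left_mono[of K M "norm x"] by (simp add: M_def mult.commute)
    then have WM: "(norm (W x))\<^sup>2 \<le> M\<^sup>2 * (norm x)\<^sup>2"
      by (metis norm_ge_zero power_mono power_mult_distrib)
    have "(norm (x - t *\<^sub>R W x))\<^sup>2 = (norm x)\<^sup>2 - 2 * t * inner (W x) x + t\<^sup>2 * (norm (W x))\<^sup>2"
      unfolding power2_norm_eq_inner power2_eq_square[of t]
      by (simp add: inner_diff inner_commute[of x "W x"] algebra_simps)
    also have "\<dots> \<le> (norm x)\<^sup>2 - 2 * t * (a * (norm x)\<^sup>2) + t\<^sup>2 * (M\<^sup>2 * (norm x)\<^sup>2)"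
      using t a(2)[of x] WM by (intro add_mono diff_mono mult_left_mono) auto
    also have "\<dots> = (1 - a\<^sup>2 / M\<^sup>2) * (norm x)\<^sup>2"
      using M by (simp add: t_def power2_eq_square field_simps)
    also have "\<dots> = (q * norm x)\<^sup>2"
      using q2 by (simp add: q_def power_mult_distrib)
    finally show "(norm (x - t *\<^sub>R W x))\<^sup>2 \<le> (q * norm x)\<^sup>2" .
  qed (use q2 in \<open>simp add: q_def\<close>)
  moreover have "0 \<le> q" "q < 1" using q2 by (auto simp: q_def)
  ultimately show thesis using t that by blast
qed

lemma coercive_surj:
  fixes W :: "'a::{real_inner,banach} \<Rightarrow> 'a"
  assumes W: "bounded_linear W" and a: "0 < a" "\<And>x. a * (norm x)\<^sup>2 \<le> inner (W x) x"
  shows "surj W"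
proof -
  interpret W: bounded_linear W by fact
  obtain t q where tq: "0 < t" "0 \<le> q" "q < 1" "\<And>x. norm (x - t *\<^sub>R W x) \<le> q * norm x"
    using coercive_contraction[OF assms] by blast
  have "\<exists>x. W x = y" for y
  proof -
    (* the fixed points of this contraction are the solutions of W x = y *)
    have "\<exists>!x. x - t *\<^sub>R W x + t *\<^sub>R y = x"
    proof (rule banach_fix_type[OF tq(2,3)], intro allI)
      fix x z
      have "x - t *\<^sub>R W x + t *\<^sub>R y - (z - t *\<^sub>R W z + t *\<^sub>R y) = (x - z) - t *\<^sub>R W (x - z)"
        by (simp add: W.diff algebra_simps)
      then show "dist (x - t *\<^sub>R W x + t *\<^sub>R y) (z - t *\<^sub>R W z + t *\<^sub>R y) \<le> q * dist x z"
        unfolding dist_norm using tq(4)[of "x - z"] by (simp only:)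
    qed
    then obtain x where "x - t *\<^sub>R W x + t *\<^sub>R y = x" by blast
    then have "W x = y" using tq(1) by (auto simp: algebra_simps)
    then show ?thesis by blast
  qed
  then show ?thesis by (metis surjI)
qed

lemma coercive_inverse:
  fixes S :: "'a::{real_inner,banach} \<Rightarrow> 'a"
  assumes S: "bounded_linear S" and b: "0 < b" "\<And>x. b * (norm x)\<^sup>2 \<le> inner (S x) x"
  obtains R where "bounded_linear R" "\<And>x. S (R x) = x" "\<And>x. R (S x) = x"
proof -
  interpret S: bounded_linear S by fact
  have below: "b * norm x \<le> norm (S x)" for x
  proof (cases "x = 0")
    case False
    have "b * norm x * norm x \<le> norm (S x) * norm x"
      using b(2)[of x] norm_cauchy_schwarz[of "S x" x] by (simp add: power2_eq_square mult.assoc)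
    then show ?thesis using False by simp
  qed simp
  have "inj S"
  proof (rule injI)
    fix x y assume "S x = S y"
    then have "b * norm (x - y) \<le> 0" using below[of "x - y"] by (simp add: S.diff)
    then show "x = y" using b(1) by (simp add: mult_le_0_iff)
  qed
  define R where "R = inv S"
  have SR: "S (R x) = x" for x
    unfolding R_def by (rule surj_f_inv_f[OF coercive_surj[OF S b]])
  have RS: "R (S x) = x" for x
    unfolding R_def by (rule inv_f_f[OF \<open>inj S\<close>])
  have "bounded_linear R"
  proof (rule bounded_linear_intro[where K="1 / b"])
    show "R (x + y) = R x + R y" for x y
      by (metis SR RS S.add)
    show "R (r *\<^sub>R x) = r *\<^sub>R R x" for r x
      by (metis SR RS S.scale)
    show "norm (R x) \<le> norm x * (1 / b)" for x
      using below[of "R x"] b(1) by (simp add: SR field_simps)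
  qed
  with SR RS show thesis using that by blast
qed

text \<open>
  A solution of \<open>(1 - Y)\<^sup>2 = 1 - X\<close> is a fixed point of \<open>Y \<mapsto> (X + Y\<^sup>2) / 2\<close>, which for \<open>\<parallel>X\<parallel> \<le> q < 1\<close>
  is a contraction of the ball of radius \<open>q\<close>. Selfadjointness and commutation with the
  commutant of \<open>X\<close> are closed conditions preserved by this map, so the fixed point has them.
\<close>

lemma blinfun_sqrt_one_minus:
  fixes X :: "'a::{real_inner,banach} \<Rightarrow>\<^sub>L 'a"
  assumes X: "norm X \<le> q" "q < 1" "selfadjoint X"
  obtains Y :: "'a \<Rightarrow>\<^sub>L 'a" where "norm Y \<le> q" "selfadjoint Y"
    "\<And>C x. bounded_linear C \<Longrightarrow> (\<And>x. C (X x) = X (C x)) \<Longrightarrow> C (Y x) = Y (C x)"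
    "\<And>x. Y x = (1/2) *\<^sub>R (X x + Y (Y x))"
proof -
  (* the closed set on which the iteration runs carries every property that Y must have *)
  define Com where "Com = {C. bounded_linear C \<and> (\<forall>x. C (X x) = X (C x))}"
  define A where "A = cball (0 :: 'a \<Rightarrow>\<^sub>L 'a) q \<inter> (\<Inter>x. \<Inter>y. {Y :: 'a \<Rightarrow>\<^sub>L 'a. inner (Y x) y = inner x (Y y)})
      \<inter> (\<Inter>C\<in>Com. \<Inter>x. {Y :: 'a \<Rightarrow>\<^sub>L 'a. C (Y x) = Y (C x)})"
  have A_iff: "Y \<in> A \<longleftrightarrow> norm Y \<le> q \<and> selfadjoint Y \<and> (\<forall>C\<in>Com. \<forall>x. C (Y x) = Y (C x))" for Y :: "'a \<Rightarrow>\<^sub>L 'a"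
    by (auto simp: A_def selfadjoint_def)
  define \<Phi> where "\<Phi> Y = (1/2) *\<^sub>R (X + (Y o\<^sub>L Y))" for Y :: "'a \<Rightarrow>\<^sub>L 'a"
  have \<Phi>: "\<Phi> Y x = (1/2) *\<^sub>R (X x + Y (Y x))" for Y :: "'a \<Rightarrow>\<^sub>L 'a" and x
    by (simp add: \<Phi>_def blinfun.scaleR_left blinfun.add_left)
  have q: "0 \<le> q" using X(1) norm_ge_zero order_trans by blast
  have "\<exists>!Y\<in>A. \<Phi> Y = Y"
  proof (rule Banach_fix[OF _ _ q X(2)])
    have "closed A"
      unfolding A_def
    proof (intro closed_Int closed_INT ballI closed_cball closed_Collect_eq)
      fix C x assume "C \<in> Com"
      then have "bounded_linear C" by (simp add: Com_def)
      then show "continuous_on UNIV (\<lambda>Y. C (blinfun_apply Y x))"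
        by (rule bounded_linear.continuous_on) (intro continuous_intros)
    qed (intro continuous_intros)+
    then show "complete A" by (simp add: complete_eq_closed)
    have "0 \<in> A" using q
      by (auto simp: A_iff selfadjoint_def Com_def linear_simps)
    then show "A \<noteq> {}" by blast
    show "\<Phi> ` A \<subseteq> A"
    proof clarify
      fix Y assume Y: "Y \<in> A"
      have "norm (Y o\<^sub>L Y) \<le> norm Y * norm Y" by (rule norm_blinfun_compose)
      also have "\<dots> \<le> q * 1" using Y X(2) q by (intro mult_mono) (auto simp: A_iff)
      finally have "norm (\<Phi> Y) \<le> q"
        using norm_triangle_ineq[of X "Y o\<^sub>L Y"] X(1) by (simp add: \<Phi>_def)
      moreover have "selfadjoint (\<Phi> Y)"
        using X(3) Y by (simp add: A_iff selfadjoint_def \<Phi> inner_add_left inner_add_right)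
      moreover have "C (\<Phi> Y x) = \<Phi> Y (C x)" if "C \<in> Com" for C x
      proof -
        have C: "bounded_linear C" using that by (simp add: Com_def)
        show ?thesis using Y that
          by (simp add: \<Phi> A_iff Com_def linear_simps[OF C])
      qed
      ultimately show "\<Phi> Y \<in> A" by (simp add: A_iff)
    qed
    fix Y Z assume YZ: "Y \<in> A" "Z \<in> A"
    (* Y^2 - Z^2 = Y (Y - Z) + (Y - Z) Z holds without commutativity *)
    have "\<Phi> Y - \<Phi> Z = (1/2) *\<^sub>R ((Y o\<^sub>L (Y - Z)) + ((Y - Z) o\<^sub>L Z))"
      by (rule blinfun_eqI) (simp add: \<Phi> blinfun.bilinear_simps algebra_simps)
    then have "norm (\<Phi> Y - \<Phi> Z) \<le> (norm (Y o\<^sub>L (Y - Z)) + norm ((Y - Z) o\<^sub>L Z)) / 2"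
      using norm_triangle_ineq[of "Y o\<^sub>L (Y - Z)" "(Y - Z) o\<^sub>L Z"] by simp
    also have "\<dots> \<le> (norm Y * norm (Y - Z) + norm (Y - Z) * norm Z) / 2"
      using norm_blinfun_compose[of Y "Y - Z"] norm_blinfun_compose[of "Y - Z" Z] by simp
    also have "\<dots> \<le> (q * norm (Y - Z) + norm (Y - Z) * q) / 2"
      using YZ q by (intro divide_right_mono add_mono mult_mono) (auto simp: A_iff)
    finally show "dist (\<Phi> Y) (\<Phi> Z) \<le> q * dist Y Z"
      by (simp add: dist_norm)
  qed
  then obtain Y where "Y \<in> A" "\<Phi> Y = Y" by blast
  then show thesis
    using that[of Y] \<Phi>[of Y] by (auto simp: A_iff Com_def)
qed

text \<open>
  The clause on the commutant is what later gives complex linearity of the root, its compatibility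
  with the support projection, and uniqueness.
\<close>

lemma coercive_sqrt:
  fixes W :: "'a::{real_inner,banach} \<Rightarrow> 'a"
  assumes W: "bounded_linear W" "selfadjoint W"
    and a: "0 < a" "\<And>x. a * (norm x)\<^sup>2 \<le> inner (W x) x"
  obtains S b where "bounded_linear S" "selfadjoint S" "\<And>x. S (S x) = W x"
    "\<forall>C. bounded_linear C \<longrightarrow> (\<forall>x. C (W x) = W (C x)) \<longrightarrow> (\<forall>x. C (S x) = S (C x))"
    "0 < b" "\<And>x. b * (norm x)\<^sup>2 \<le> inner (S x) x"
proof -
  obtain t q where tq: "0 < t" "0 \<le> q" "q < 1" "\<And>x. norm (x - t *\<^sub>R W x) \<le> q * norm x"
    using coercive_contraction[OF W(1) a] by blast
  define X where "X = Blinfun (\<lambda>x. x - t *\<^sub>R W x)"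
  have X: "X x = x - t *\<^sub>R W x" for x
    unfolding X_def
    by (rule bounded_linear_Blinfun_apply[THEN fun_cong])
      (intro bounded_linear_sub bounded_linear_ident bounded_linear_compose[OF bounded_linear_scaleR_right W(1)])
  have "norm X \<le> q"
    by (rule norm_blinfun_bound) (simp_all add: tq X)
  moreover have "selfadjoint X"
    using W(2) by (simp add: selfadjoint_def X inner_diff_left inner_diff_right)
  ultimately obtain Y :: "'a \<Rightarrow>\<^sub>L 'a" where Y: "norm Y \<le> q" "selfadjoint Y"
    "\<And>C x. bounded_linear C \<Longrightarrow> (\<And>x. C (X x) = X (C x)) \<Longrightarrow> C (Y x) = Y (C x)"
    "\<And>x. Y x = (1/2) *\<^sub>R (X x + Y (Y x))"
    using blinfun_sqrt_one_minus[OF _ tq(3)] by blast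
  (* (1 - Y)^2 = 1 - X = t W *)
  define r where "r = 1 / sqrt t"
  have r: "0 < r" "r * r * t = 1"
    using tq(1) by (auto simp: r_def field_simps)
  define S where "S x = r *\<^sub>R (x - Y x)" for x
  show thesis
  proof (rule that[of S "r * (1 - q)"])
    show bS: "bounded_linear S"
      unfolding S_def
      by (intro bounded_linear_compose[OF bounded_linear_scaleR_right] bounded_linear_sub
          bounded_linear_ident blinfun.bounded_linear_right)
    show "selfadjoint S"
      using Y(2) by (simp add: selfadjoint_def S_def inner_diff_left inner_diff_right)
    show "S (S x) = W x" for x
    proof -
      have "S (S x) = (r * r) *\<^sub>R (x - 2 *\<^sub>R Y x + Y (Y x))"
        by (simp add: S_def blinfun.bilinear_simps algebra_simps scaleR_2)
      also have "2 *\<^sub>R Y x = X x + Y (Y x)"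
      proof -
        have "2 *\<^sub>R (1/2) *\<^sub>R v = v" for v :: 'a by simp
        then show ?thesis using arg_cong[OF Y(4)[of x], of "\<lambda>v. 2 *\<^sub>R v"] by (simp only:)
      qed
      finally show ?thesis using r(2) by (simp add: X)
    qed
    show "\<forall>C. bounded_linear C \<longrightarrow> (\<forall>x. C (W x) = W (C x)) \<longrightarrow> (\<forall>x. C (S x) = S (C x))"
    proof (intro allI impI)
      fix C x assume C: "bounded_linear C" "\<forall>x. C (W x) = W (C x)"
      have "C (Y x) = Y (C x)"
        using C by (intro Y(3)) (simp_all add: X linear_simps[OF C(1)])
      then show "C (S x) = S (C x)" by (simp add: S_def linear_simps[OF C(1)])
    qed
    show "0 < r * (1 - q)" using r tq by simp
    show "r * (1 - q) * (norm x)\<^sup>2 \<le> inner (S x) x" for x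
    proof -
      have "inner (Y x) x \<le> norm (Y x) * norm x" by (rule norm_cauchy_schwarz)
      also have "\<dots> \<le> (q * norm x) * norm x"
        using norm_blinfun[of Y x] Y(1) mult_right_mono[OF Y(1), of "norm x"]
        by (intro mult_right_mono) auto
      finally have "(1 - q) * (norm x)\<^sup>2 \<le> inner (x - Y x) x"
        by (simp add: inner_diff_left power2_norm_eq_inner[symmetric] power2_eq_square algebra_simps)
      then show ?thesis using r(1) by (simp add: S_def mult.assoc)
    qed
  qed
qed

text \<open>
  For \<open>y = S x - R x\<close>, commutation gives \<open>(S + R) y = (S\<^sup>2 - R\<^sup>2) x = 0\<close>. Two positive forms whose
  sum vanishes at \<open>y\<close> both vanish there, so \<open>S y = R y = 0\<close>, and then
  \<open>\<parallel>y\<parallel>\<^sup>2 = \<langle>x, (S - R) y\<rangle> = 0\<close>.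
\<close>

lemma positive_sqrt_unique:
  fixes S R :: "'a::real_inner \<Rightarrow> 'a"
  assumes S: "linear S" "selfadjoint S" "\<And>x. 0 \<le> inner (S x) x"
    and R: "linear R" "selfadjoint R" "\<And>x. 0 \<le> inner (R x) x"
    and eq: "\<And>x. S (S x) = R (R x)" and comm: "\<And>x. R (S x) = S (R x)"
  shows "S = R"
proof
  fix x
  define y where "y = S x - R x"
  have Sy: "S y + R y = 0"
    unfolding y_def linear_diff[OF S(1)] linear_diff[OF R(1)] eq comm by simp
  then have "inner (S y) y + inner (R y) y = 0"
    by (metis inner_add_left inner_zero_left)
  then have "inner (S y) y = 0" "inner (R y) y = 0"
    using S(3)[of y] R(3)[of y] by linarith+
  (* a positive form that vanishes at y has y in its radical; the step s = - p / (k + 1)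
     is small enough for the linear term to beat the quadratic one *)
  have rad: "T y = 0" if T: "linear T" "selfadjoint T" "\<And>x. 0 \<le> inner (T x) x" and 0: "inner (T y) y = 0" for T :: "'a \<Rightarrow> 'a"
  proof -
    have *: "0 \<le> 2 * s * inner (T y) (T y) + s\<^sup>2 * inner (T (T y)) (T y)" for s
    proof -
      have "0 \<le> inner (T (y + s *\<^sub>R T y)) (y + s *\<^sub>R T y)" by (rule T(3))
      also have "\<dots> = 2 * s * inner (T y) (T y) + s\<^sup>2 * inner (T (T y)) (T y)"
        using 0 selfadjointD[OF T(2), of "T y" y]
        by (simp add: linear_add[OF T(1)] linear_cmul[OF T(1)] inner_add power2_eq_square algebra_simps)
      finally show ?thesis .
    qed
    define p where "p = inner (T y) (T y)"
    define k where "k = inner (T (T y)) (T y)"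
    have k: "0 \<le> k" unfolding k_def by (rule T(3))
    have "0 \<le> (k + 1)\<^sup>2 * (2 * (- (p / (k + 1))) * p + (- (p / (k + 1)))\<^sup>2 * k)"
      using *[of "- (p / (k + 1))"] by (simp add: p_def k_def)
    also have "\<dots> = - (p\<^sup>2 * (k + 2))"
      using k by (simp add: power2_eq_square divide_simps) (simp add: algebra_simps)
    finally have "p\<^sup>2 * (k + 2) \<le> 0" by simp
    then have "p = 0" using k by (simp add: mult_le_0_iff)
    then show ?thesis by (simp add: p_def)
  qed
  have "S y = 0" "R y = 0"
    by (rule rad S R \<open>inner (S y) y = 0\<close> \<open>inner (R y) y = 0\<close>)+
  then have "inner y y = 0"
    using selfadjointD[OF S(2), of x y] selfadjointD[OF R(2), of x y]
    by (simp add: y_def inner_diff_left)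
  then show "S x = R x" by (simp add: y_def)
qed

section \<open>Complex-linear operators\<close>

lemma cinner_add_right: "cinner x (y + z) = cinner x y + cinner x z"
  by (metis cinner_add_left cinner_commute complex_cnj_add)

lemma cinner_scaleC_right: "cinner x (c *\<^sub>C y) = cnj c * cinner x y"
  by (metis cinner_commute cinner_scaleC_left complex_cnj_mult)

lemma Im_cinner: "Im (cinner x y) = - inner (\<i> *\<^sub>C x) y"
  by (simp add: inner_eq_Re_cinner cinner_scaleC_left)

lemma norm_scaleC: "norm (c *\<^sub>C x) = cmod c * norm x"
proof -
  have "complex_of_real ((norm (c *\<^sub>C x))\<^sup>2) = complex_of_real ((cmod c * norm x)\<^sup>2)"
    unfolding cinner_self[symmetric] cinner_scaleC_left cinner_scaleC_right
    by (simp only: cinner_self power_mult_distrib of_real_mult complex_norm_square[of c] mult.assoc mult.left_commute)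
  then show ?thesis by (simp only: of_real_eq_iff power2_eq_iff_nonneg norm_ge_zero mult_nonneg_nonneg)
qed

lemma bounded_linear_scaleC: "bounded_linear (\<lambda>x. c *\<^sub>C x)"
  by (rule bounded_linear_intro[where K="cmod c"])
    (simp_all add: scaleC_add_right norm_scaleC scaleC_scaleC mult.commute flip: scaleC_of_real)

lemma bounded_clinearD:
  assumes "bounded_clinear T"
  shows "bounded_linear T" "T (c *\<^sub>C x) = c *\<^sub>C T x"
  using assms by (auto simp: bounded_clinear_def)

lemma bounded_clinear_compose:
  "bounded_clinear S \<Longrightarrow> bounded_clinear T \<Longrightarrow> bounded_clinear (\<lambda>x. S (T x))"
  by (simp add: bounded_clinear_def bounded_linear_compose)

lemma bounded_clinear_diff:
  "bounded_clinear S \<Longrightarrow> bounded_clinear T \<Longrightarrow> bounded_clinear (\<lambda>x. S x - T x)"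
  by (simp add: bounded_clinear_def bounded_linear_sub linear_simps[OF bounded_linear_scaleC])

text \<open>
  The complex inner product is determined by its real part, so the adjoint with respect to the
  real inner product of a complex-linear operator is also its complex adjoint.
\<close>

lemma cinner_adjoint:
  fixes F :: "'a::complex_hilbert \<Rightarrow> 'b::complex_inner"
  assumes "bounded_clinear F"
  shows "cinner (F x) y = cinner x (adjoint F y)"
  by (rule complex_eqI)
    (simp_all add: Im_cinner bounded_clinearD(2)[OF assms, symmetric]
      inner_adjoint[OF bounded_clinearD(1)[OF assms]] flip: inner_eq_Re_cinner)

lemma cadjoint_eq_adjoint:
  fixes F :: "'a::complex_hilbert \<Rightarrow> 'b::complex_inner"
  assumes "bounded_clinear F"
  shows "cadjoint F = adjoint F"
  unfolding cadjoint_def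
proof (rule the_equality)
  fix G assume G: "\<forall>x y. cinner (F x) y = cinner x (G y)"
  show "G = adjoint F"
    by (rule adjoint_unique[symmetric]) (simp add: inner_eq_Re_cinner G)
qed (simp add: cinner_adjoint[OF assms])

lemma bounded_clinear_adjoint:
  fixes F :: "'a::complex_hilbert \<Rightarrow> 'b::complex_inner"
  assumes F: "bounded_clinear F"
  shows "bounded_clinear (adjoint F)"
  unfolding bounded_clinear_def
proof (intro conjI allI)
  show "bounded_linear (adjoint F)"
    by (rule bounded_linear_adjoint[OF bounded_clinearD(1)[OF F]])
  fix c y
  have "inner x (adjoint F (c *\<^sub>C y)) = inner x (c *\<^sub>C adjoint F y)" for x
    unfolding inner_eq_Re_cinner cinner_adjoint[OF F, symmetric] cinner_scaleC_right ..
  then show "adjoint F (c *\<^sub>C y) = c *\<^sub>C adjoint F y"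
    by (metis vector_eq_ldot)
qed

text \<open>
  Over the complex numbers a real quadratic form comes from a selfadjoint operator: polarization
  at \<open>x + \<i> y\<close> shows that the real parts of \<open>\<langle>T x, y\<rangle>\<close> and \<open>\<langle>T y, x\<rangle>\<close> agree.
\<close>

lemma positive_operator_iff:
  "positive_operator T \<longleftrightarrow> bounded_clinear T \<and> selfadjoint T \<and> (\<forall>x. 0 \<le> inner (T x) x)"
  (is "?l \<longleftrightarrow> ?r")
proof
  assume ?l
  then have T: "bounded_clinear T" and real: "\<And>x. Im (cinner (T x) x) = 0"
    and pos: "\<And>x. 0 \<le> inner (T x) x"
    by (auto simp: positive_operator_def inner_eq_Re_cinner complex_is_Real_iff)
  have "inner (T x) y = inner x (T y)" for x y
  proof -
    have "Im (cinner (T (x + \<i> *\<^sub>C y)) (x + \<i> *\<^sub>C y)) = 0" by (rule real)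
    then have "Re (cinner (T y) x) = Re (cinner (T x) y)"
      using real[of x] real[of y]
      by (simp add: linear_simps[OF bounded_clinearD(1)[OF T]] bounded_clinearD(2)[OF T]
          cinner_add_left cinner_add_right cinner_scaleC_left cinner_scaleC_right)
    then show ?thesis by (metis inner_commute inner_eq_Re_cinner)
  qed
  with T pos show ?r by (simp add: selfadjoint_def)
next
  assume r: ?r
  then have T: "bounded_clinear T" "selfadjoint T" by auto
  have "Im (cinner (T x) x) = 0" for x
  proof -
    have "Im (cinner (T x) x) = - inner (T (\<i> *\<^sub>C x)) x"
      by (simp add: Im_cinner bounded_clinearD(2)[OF T(1)])
    also have "\<dots> = - inner (\<i> *\<^sub>C x) (T x)" by (simp add: selfadjointD[OF T(2)])
    also have "\<dots> = Im (cinner x (T x))" by (simp add: Im_cinner)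
    also have "\<dots> = - Im (cinner (T x) x)" by (subst cinner_commute) simp
    finally show ?thesis by simp
  qed
  with r show ?l
    by (auto simp: positive_operator_def complex_is_Real_iff inner_eq_Re_cinner)
qed

section \<open>The support of an operator\<close>

lemma closed_kernel: "bounded_linear F \<Longrightarrow> closed (kernel F)"
  unfolding kernel_def by (intro closed_Collect_eq linear_continuous_on continuous_on_const)

lemma subspace_kernel: "bounded_linear F \<Longrightarrow> subspace (kernel F)"
  by (auto simp: kernel_def subspace_def linear_simps)

text \<open>
  The projection onto the orthogonal complement of the kernel, called \<open>P\<close> in the outline above.
\<close>

definition support_projection :: "('a::complex_inner \<Rightarrow> 'b::complex_inner) \<Rightarrow> 'a \<Rightarrow> 'a" where
  "support_projection F x = x - orthogonal_projection (kernel F) x"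

context
  fixes F :: "'a::complex_hilbert \<Rightarrow> 'b::complex_inner"
  assumes F: "bounded_linear F"
begin

lemmas kernel_projection = closed_kernel[OF F] subspace_kernel[OF F]

lemma bounded_linear_support_projection: "bounded_linear (support_projection F)"
  unfolding support_projection_def
  by (intro bounded_linear_sub bounded_linear_ident
      bounded_linear_orthogonal_projection[OF kernel_projection])

lemma selfadjoint_support_projection: "selfadjoint (support_projection F)"
  using selfadjoint_orthogonal_projection[OF kernel_projection]
  by (simp add: selfadjoint_def support_projection_def inner_diff_left inner_diff_right)

lemma apply_support_projection: "F (support_projection F x) = F x"
  using orthogonal_projection_in[OF kernel_projection, of x]
  by (simp add: support_projection_def linear_simps[OF F] kernel_def)

lemma support_projection_orthogonal: "F z = 0 \<Longrightarrow> inner (support_projection F x) z = 0"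
  unfolding support_projection_def
  by (rule orthogonal_projection_residual[OF kernel_projection]) (simp add: kernel_def)

lemma support_projection_eq_self:
  assumes "\<And>z. F z = 0 \<Longrightarrow> inner x z = 0"
  shows "support_projection F x = x"
proof -
  have "orthogonal_projection (kernel F) x = 0"
    by (rule orthogonal_projection_eqI[OF kernel_projection])
      (use assms in \<open>auto simp: kernel_def linear_simps[OF F]\<close>)
  then show ?thesis by (simp add: support_projection_def)
qed

lemma support_projection_idem: "support_projection F (support_projection F x) = support_projection F x"
  by (rule support_projection_eq_self) (rule support_projection_orthogonal)

lemma support_projection_eq_0_iff: "support_projection F x = 0 \<longleftrightarrow> F x = 0"
proof
  assume "support_projection F x = 0"
  then show "F x = 0" using apply_support_projection[of x] by (simp add: linear_simps[OF F])
next
  assume "F x = 0"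
  then show "support_projection F x = 0"
    using orthogonal_projection_id[OF kernel_projection, of x]
    by (simp add: support_projection_def kernel_def)
qed

lemma support_projection_pythagoras:
  "(norm x)\<^sup>2 = (norm (support_projection F x))\<^sup>2 + (norm (x - support_projection F x))\<^sup>2"
  and inner_support_projection_self: "inner (support_projection F x) x = (norm (support_projection F x))\<^sup>2"
proof -
  let ?P = "support_projection F"
  have *: "inner (?P x) (x - ?P x) = 0"
    by (rule support_projection_orthogonal) (simp add: linear_simps[OF F] apply_support_projection)
  then show "inner (?P x) x = (norm (?P x))\<^sup>2"
    by (simp add: inner_diff_right power2_norm_eq_inner)
  then show "(norm x)\<^sup>2 = (norm (?P x))\<^sup>2 + (norm (x - ?P x))\<^sup>2"
    by (simp add: power2_norm_eq_inner inner_diff inner_commute[of x "?P x"])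
qed

lemma norm_support_projection_le: "norm (support_projection F x) \<le> norm x"
  by (rule power2_le_imp_le) (use support_projection_pythagoras[of x] in simp_all)

lemma support_projection_commutes:
  assumes "linear C" "\<And>z. F z = 0 \<Longrightarrow> F (C z) = 0"
    and "\<And>x z. (\<And>z. F z = 0 \<Longrightarrow> inner x z = 0) \<Longrightarrow> F z = 0 \<Longrightarrow> inner (C x) z = 0"
  shows "support_projection F (C x) = C (support_projection F x)"
  using orthogonal_projection_commutes[OF kernel_projection assms(1), of x] assms(2,3)
  by (simp add: support_projection_def linear_diff[OF assms(1)] kernel_def)

end

lemma support_projection_scaleC:
  fixes F :: "'a::complex_hilbert \<Rightarrow> 'b::complex_inner"
  assumes F: "bounded_clinear F"
  shows "support_projection F (c *\<^sub>C x) = c *\<^sub>C support_projection F x"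
proof (rule support_projection_commutes[OF bounded_clinearD(1)[OF F]])
  show "linear (\<lambda>x :: 'a. c *\<^sub>C x)" by (rule bounded_linear.linear[OF bounded_linear_scaleC])
  show "F (c *\<^sub>C z) = 0" if "F z = 0" for z
    using that by (simp add: bounded_clinearD(2)[OF F])
  fix x z assume x: "\<And>z. F z = 0 \<Longrightarrow> inner x z = 0" and z: "F z = 0"
  have "inner (c *\<^sub>C x) z = inner x (cnj c *\<^sub>C z)"
    by (simp add: inner_eq_Re_cinner cinner_scaleC_left cinner_scaleC_right)
  also have "\<dots> = 0" by (rule x) (simp add: z bounded_clinearD(2)[OF F])
  finally show "inner (c *\<^sub>C x) z = 0" .
qed

text \<open>
  A lower bound for \<open>F\<^sup>*\<close> on the range of \<open>F\<close> (the lower frame bound) becomes the same lower bound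
  for \<open>F\<close> on the complement of its kernel. It is checked on the range of \<open>F\<^sup>* F\<close> and
  extends to the closure of that range, which is the complement of the kernel.
\<close>

lemma bounded_below_on_support:
  fixes F :: "'a::complex_hilbert \<Rightarrow> 'b::complex_hilbert"
  assumes F: "bounded_linear F" and c: "0 < c"
    and below: "\<And>x. c * norm (F x) \<le> norm (adjoint F (F x))"
  shows "c * norm (support_projection F x) \<le> norm (F x)"
proof -
  define T where "T x = adjoint F (F x)" for x
  have T: "bounded_linear T"
    unfolding T_def by (rule bounded_linear_compose[OF bounded_linear_adjoint[OF F] F])
  have inner_T: "inner (T x) y = inner (F x) (F y)" for x y
    by (simp add: T_def inner_adjoint[OF F] inner_commute[of _ y] inner_commute[of _ "F y"])
  (* with g = F z, both sides are compared through the inner product of g and F (T z),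
     which is the square of the norm of T z *)
  have range_T: "c * norm (T z) \<le> norm (F (T z))" for z
  proof (cases "F z = 0")
    case False
    have "c * norm (F z) * norm (T z) \<le> norm (T z) * norm (T z)"
      using below[of z] by (simp add: T_def mult_right_mono)
    also have "\<dots> = inner (F z) (F (T z))"
      by (simp add: inner_T[symmetric] power2_norm_eq_inner[symmetric] power2_eq_square)
    also have "\<dots> \<le> norm (F z) * norm (F (T z))" by (rule norm_cauchy_schwarz)
    finally show ?thesis using False by (simp add: mult.assoc mult.left_commute)
  next
    case True
    then show ?thesis
      by (simp add: T_def linear_simps[OF F] linear_simps[OF bounded_linear_adjoint[OF F]])
  qed
  (* the vectors T z are dense in the orthogonal complement of the kernel *)
  define M where "M = closure (range T)"
  have M: "closed M" "subspace M"
    unfolding M_def using T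
    by (auto intro!: subspace_closure linear_subspace_image bounded_linear.linear)
  have closure_bound: "M \<subseteq> {y. c * norm y \<le> norm (F y)}"
    unfolding M_def using range_T
    by (intro closure_minimal closed_Collect_le continuous_intros linear_continuous_on[OF F]) auto
  let ?y = "support_projection F x"
  let ?r = "?y - orthogonal_projection M ?y"
  (* the residual is orthogonal to the range of T, so it lies in the kernel of F *)
  have "inner ?r (T w) = 0" for w
    by (rule orthogonal_projection_residual[OF M]) (simp add: M_def closure_subset[THEN subsetD])
  from this[of ?r] have "F ?r = 0" by (simp add: inner_commute[of ?r "T ?r"] inner_T)
  then have "inner ?y ?r = 0" by (rule support_projection_orthogonal[OF F])
  moreover have "inner ?r (orthogonal_projection M ?y) = 0"
    by (rule orthogonal_projection_residual[OF M orthogonal_projection_in[OF M]])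
  ultimately have "inner ?r ?r = 0"
    by (simp only: inner_diff_right[of ?r] inner_commute[of ?r ?y])
  then have "?y = orthogonal_projection M ?y" by simp
  then have "?y \<in> M" using orthogonal_projection_in[OF M, of ?y] by simp
  then show ?thesis using closure_bound by (auto simp: apply_support_projection[OF F])
qed

section \<open>The polar decomposition of an operator with closed range\<close>

text \<open>
  The lower bound on the support says that \<open>F\<close> has closed range. It makes \<open>W = F\<^sup>* F + (1 - P)\<close>
  coercive, and with \<open>S\<close> the square root of \<open>W\<close> one gets \<open>|F| = S P\<close> and \<open>U = F S\<^sup>-\<^sup>1\<close>. The proof
  also shows that these are the only operators with the properties by which \<open>|F|\<close> and \<open>U\<close> are
  defined, so that the defining descriptions denote them.
\<close>

proposition polar_decomposition_closed_range:
  fixes F :: "'a::complex_hilbert \<Rightarrow> 'b::complex_hilbert"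
  assumes F: "bounded_clinear F" and c: "0 < c"
    and below: "\<And>x. c * norm (support_projection F x) \<le> norm (F x)"
  shows positive_abs_operator: "positive_operator (abs_operator F)"
    and abs_operator_square: "abs_operator F (abs_operator F x) = adjoint F (F x)"
    and partial_isometry_polar_isometry: "partial_isometry (polar_isometry F)"
    and polar_isometry_abs_operator: "polar_isometry F (abs_operator F x) = F x"
    and kernel_polar_isometry: "kernel (polar_isometry F) = kernel F"
proof -
  have bF: "bounded_linear F" using F by (rule bounded_clinearD)
  define P where "P = support_projection F"
  note P_lemmas = apply_support_projection[OF bF, folded P_def]
    support_projection_orthogonal[OF bF, folded P_def]
    support_projection_eq_self[OF bF, folded P_def]
    support_projection_eq_0_iff[OF bF, folded P_def]
    support_projection_idem[OF bF, folded P_def]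
  have P: "bounded_linear P" "selfadjoint P"
    unfolding P_def by (rule bounded_linear_support_projection selfadjoint_support_projection bF)+
  define T where "T x = adjoint F (F x)" for x
  have cT: "bounded_clinear T"
    unfolding T_def by (rule bounded_clinear_compose[OF bounded_clinear_adjoint[OF F] F])
  then have bT: "bounded_linear T" by (rule bounded_clinearD)
  have inner_T: "inner (T x) y = inner (F x) (F y)" for x y
    unfolding T_def inner_commute[of _ y] inner_adjoint[OF bF, symmetric] by (rule inner_commute)
  have T: "selfadjoint T"
    unfolding selfadjoint_def inner_T inner_commute[of _ "T _"] by (simp add: inner_commute)
  have PT: "P (T x) = T x" for x
    by (rule P_lemmas(3)) (simp add: inner_T)
  have TP: "T (P x) = T x" for x
    by (simp add: T_def P_lemmas)
  have T_eq_0: "T x = 0 \<longleftrightarrow> F x = 0" for x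
  proof
    assume "T x = 0"
    then show "F x = 0" using inner_T[of x x] by simp
  qed (simp add: T_def linear_simps[OF bounded_linear_adjoint[OF bF]])

  (* T need not be injective; adding the projection onto the kernel makes it coercive *)
  define W where "W x = T x + (x - P x)" for x
  have W: "bounded_linear W"
    unfolding W_def by (intro bounded_linear_add bounded_linear_sub bounded_linear_ident bT P)
  have saW: "selfadjoint W"
    using T P(2) by (simp add: selfadjoint_def W_def inner_add_left inner_add_right inner_diff_left inner_diff_right)
  have W_coercive: "min (c\<^sup>2) 1 * (norm x)\<^sup>2 \<le> inner (W x) x" for x
  proof -
    have "(c * norm (P x))\<^sup>2 \<le> (norm (F x))\<^sup>2"
      using below[of x] c by (intro power_mono) (auto simp: P_def)
    then have 1: "c\<^sup>2 * (norm (P x))\<^sup>2 \<le> inner (T x) x"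
      by (simp add: inner_T power_mult_distrib power2_norm_eq_inner)
    have pyth: "(norm x)\<^sup>2 = (norm (P x))\<^sup>2 + (norm (x - P x))\<^sup>2" "inner (P x) x = (norm (P x))\<^sup>2"
      unfolding P_def by (rule support_projection_pythagoras[OF bF] inner_support_projection_self[OF bF])+
    then have 2: "inner (x - P x) x = (norm (x - P x))\<^sup>2"
      by (simp add: inner_diff_left power2_norm_eq_inner[symmetric])
    have "min (c\<^sup>2) 1 * (norm x)\<^sup>2 = min (c\<^sup>2) 1 * (norm (P x))\<^sup>2 + min (c\<^sup>2) 1 * (norm (x - P x))\<^sup>2"
      by (simp only: pyth(1) distrib_left)
    also have "\<dots> \<le> c\<^sup>2 * (norm (P x))\<^sup>2 + 1 * (norm (x - P x))\<^sup>2"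
      by (intro add_mono mult_right_mono) auto
    also have "\<dots> \<le> inner (W x) x"
      using 1 by (simp add: W_def inner_add_left 2)
    finally show ?thesis .
  qed
  have a: "0 < min (c\<^sup>2) 1" using c by simp
  obtain S b where S: "bounded_linear S" "selfadjoint S" "\<And>x. S (S x) = W x"
    "\<forall>C. bounded_linear C \<longrightarrow> (\<forall>x. C (W x) = W (C x)) \<longrightarrow> (\<forall>x. C (S x) = S (C x))"
    and b: "0 < b" "\<And>x. b * (norm x)\<^sup>2 \<le> inner (S x) x"
    by (rule coercive_sqrt[OF W saW a W_coercive]) (rule that)
  note S_commutes = S(4)[rule_format, rotated]
  obtain R where R: "bounded_linear R" "\<And>x. S (R x) = x" "\<And>x. R (S x) = x"
    by (rule coercive_inverse[OF S(1) b]) (rule that)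
  have PW: "P (W x) = T x" and WP: "W (P x) = T x" for x
    by (simp_all add: W_def linear_simps[OF P(1)] PT TP P_lemmas)
  have PS: "P (S x) = S (P x)" for x
    by (rule S_commutes[OF _ P(1)]) (simp add: PW WP)
  have scaleS: "S (k *\<^sub>C x) = k *\<^sub>C S x" for k x
    by (rule S_commutes[OF _ bounded_linear_scaleC, symmetric])
      (simp add: W_def P_def scaleC_add_right support_projection_scaleC[OF F]
        bounded_clinearD(2)[OF cT] linear_simps(2)[OF bounded_linear_scaleC])
  (* W agrees with T on the support of F, so cutting its square root down to the support gives |F| *)
  define A where "A x = S (P x)" for x
  have A: "positive_operator A"
    unfolding positive_operator_iff
  proof (intro conjI allI)
    show "bounded_clinear A"
      unfolding bounded_clinear_def
      using bounded_linear_compose[OF S(1) P(1)]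
      by (simp add: A_def[abs_def] scaleS support_projection_scaleC[OF F] P_def)
    show "selfadjoint A"
      by (simp add: selfadjoint_def A_def selfadjointD[OF S(2)] selfadjointD[OF P(2)] PS)
    fix x
    have "0 \<le> b * (norm (P x))\<^sup>2" using b(1) by simp
    also have "\<dots> \<le> inner (S (P x)) (P x)" by (rule b(2))
    also have "\<dots> = inner (P (S (P x))) x" by (simp add: selfadjointD[OF P(2)])
    also have "\<dots> = inner (A x) x" by (simp add: PS A_def P_lemmas)
    finally show "0 \<le> inner (A x) x" .
  qed
  have AA: "A (A x) = T x" for x
    by (simp add: A_def PS P_lemmas S(3) WP)
  have abs_eq: "abs_operator F = A"
    unfolding abs_operator_def sqrt_operator_def cadjoint_eq_adjoint[OF F]
  proof (rule the_equality)
    show "positive_operator A \<and> A \<circ> A = adjoint F \<circ> F"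
      using A by (simp add: fun_eq_iff AA T_def)
    fix B assume "positive_operator B \<and> B \<circ> B = adjoint F \<circ> F"
    then have B: "bounded_linear B" "selfadjoint B" "\<And>x. 0 \<le> inner (B x) x" and BB: "\<And>x. B (B x) = T x"
      by (auto simp: positive_operator_iff bounded_clinear_def fun_eq_iff T_def)
    have BT: "B (T x) = T (B x)" for x
      by (simp flip: BB)
    (* B commutes with its own square T, and with P because T determines the kernel;
       hence with W, hence with S and A *)
    have B_kernel: "B z = 0" if "F z = 0" for z
    proof -
      have "inner (B z) (B z) = inner z (T z)" by (simp add: selfadjointD[OF B(2)] BB)
      also have "\<dots> = 0" using that T_eq_0[of z] by simp
      finally show ?thesis by simp
    qed
    have BP: "P (B x) = B (P x)" for x
      unfolding P_def
    proof (rule support_projection_commutes[OF bF bounded_linear.linear[OF B(1)]])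
      show "F (B z) = 0" if "F z = 0" for z
        using B_kernel[OF that] by (simp add: linear_simps[OF bF])
      show "inner (B x) z = 0" if "F z = 0" for x z
        using B_kernel[OF that] by (simp add: selfadjointD[OF B(2)])
    qed
    have "B (S x) = S (B x)" for x
      by (rule S_commutes[OF _ B(1)]) (simp add: W_def linear_simps[OF B(1)] BT BP)
    then have comm: "A (B x) = B (A x)" for x
      by (simp add: A_def BP)
    show "B = A"
      using A B by (intro positive_sqrt_unique)
        (auto simp: positive_operator_iff bounded_clinear_def BB AA comm bounded_linear.linear)
  qed

  (* A = S P has the inverse R on the support, so U = F R is the only candidate there;
     it vanishes on the kernel because R commutes with P and F = F P *)
  define U where "U x = F (R x)" for x
  have PR: "P (R x) = R (P x)" for x
    by (metis PS R(2,3))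
  have norm_U: "norm (U x) = norm (P x)" for x
  proof -
    have "inner (U x) (U x) = inner (W (P (R x))) (R x)"
      by (simp add: U_def inner_T[symmetric] WP)
    also have "\<dots> = inner (P (S (R x))) (S (R x))"
      by (simp add: S(3)[symmetric] selfadjointD[OF S(2)] PS)
    also have "\<dots> = (norm (P x))\<^sup>2"
      using inner_support_projection_self[OF bF, of x] by (simp add: R(2) P_def)
    finally show ?thesis by (simp add: norm_eq_sqrt_inner)
  qed
  have U0: "U x = 0 \<longleftrightarrow> F x = 0" for x
    using norm_U[of x] P_lemmas(4)[of x] by (metis norm_eq_zero)
  then have ker: "kernel U = kernel F" by (simp add: kernel_def)
  have UA: "U (A x) = F x" for x
    by (simp add: U_def A_def R(3) P_lemmas)
  have U: "partial_isometry U"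
    unfolding partial_isometry_def
  proof (intro conjI allI impI)
    have "R (k *\<^sub>C x) = k *\<^sub>C R x" for k x
      by (metis R(2,3) scaleS)
    then show "bounded_clinear U"
      unfolding bounded_clinear_def
      using bounded_linear_compose[OF bF R(1)] by (simp add: U_def[abs_def] bounded_clinearD(2)[OF F])
    fix x assume "\<forall>z\<in>kernel U. cinner x z = 0"
    then have "P x = x"
      by (intro P_lemmas(3)) (simp add: kernel_def U0 inner_eq_Re_cinner)
    then show "norm (U x) = norm x" by (simp add: norm_U)
  qed
  have polar_eq: "polar_isometry F = U"
    unfolding polar_isometry_def abs_eq
  proof (rule the_equality)
    show "partial_isometry U \<and> F = U \<circ> A \<and> kernel U = kernel F"
      using U ker by (simp add: fun_eq_iff UA)
    fix V assume "partial_isometry V \<and> F = V \<circ> A \<and> kernel V = kernel F"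
    then have V: "bounded_linear V" "\<And>x. V (A x) = F x" "\<And>x. V x = 0 \<longleftrightarrow> F x = 0"
      by (auto simp: partial_isometry_def bounded_clinear_def fun_eq_iff kernel_def)
    show "V = U"
    proof
      fix x
      have "V (x - P x) = 0" unfolding V(3) by (simp add: linear_simps[OF bF] P_lemmas)
      then have "V x = V (P x)" by (simp add: linear_simps[OF V(1)])
      also have "P x = A (R x)" by (simp add: A_def PR[symmetric] PS[symmetric] R(2))
      also have "V (A (R x)) = U x" by (simp add: V(2) U_def)
      finally show "V x = U x" .
    qed
  qed
  show "positive_operator (abs_operator F)" "abs_operator F (abs_operator F x) = adjoint F (F x)"
    "partial_isometry (polar_isometry F)" "polar_isometry F (abs_operator F x) = F x"
    "kernel (polar_isometry F) = kernel F"
    by (simp_all add: abs_eq polar_eq A U ker UA AA T_def)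
qed

lemma norm_partial_isometry:
  fixes U :: "'a::complex_hilbert \<Rightarrow> 'b::complex_inner"
  assumes U: "partial_isometry U"
  shows "norm (U x) = norm (support_projection U x)"
proof -
  let ?P = "support_projection U"
  have cU: "bounded_clinear U" and bU: "bounded_linear U"
    using U by (auto simp: partial_isometry_def bounded_clinear_def)
  have "cinner (?P x) z = 0" if "z \<in> kernel U" for z
    using that support_projection_orthogonal[OF bU, of z x] support_projection_orthogonal[OF bU, of "\<i> *\<^sub>C z" x]
    by (intro complex_eqI)
      (auto simp: kernel_def inner_eq_Re_cinner cinner_scaleC_right bounded_clinearD(2)[OF cU])
  then have "norm (U (?P x)) = norm (?P x)"
    using U by (simp add: partial_isometry_def)
  then show ?thesis by (simp add: apply_support_projection[OF bU])
qed

text \<open>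
  On the support the operator \<open>U\<^sup>* U\<close> is the identity, since \<open>U\<close> is isometric there and \<open>U\<^sup>*\<close> is
  a contraction.
\<close>

lemma partial_isometry_adjoint:
  fixes U :: "'a::complex_hilbert \<Rightarrow> 'b::complex_inner"
  assumes U: "partial_isometry U"
  shows "U (adjoint U (U x)) = U x"
proof -
  let ?P = "support_projection U"
  have bU: "bounded_linear U"
    using U by (auto simp: partial_isometry_def bounded_clinear_def)
  have "norm (U x) \<le> norm x" for x
    by (simp add: norm_partial_isometry[OF U] norm_support_projection_le[OF bU])
  then have "norm (adjoint U y) \<le> norm y" for y
    by (rule adjoint_contraction[OF bU])
  moreover have "norm (U (?P x)) = norm (?P x)"
    by (simp add: norm_partial_isometry[OF U] support_projection_idem[OF bU])
  ultimately have "adjoint U (U (?P x)) = ?P x"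
    by (rule contraction_inverts_isometric_part[OF inner_adjoint[OF bU]])
  then show ?thesis by (simp add: apply_support_projection[OF bU])
qed

section \<open>Hilbert--Schmidt operators on the sequence space\<close>

lemma ell2_nth_basis: "ell2_nth (ell2_basis i) n = (if n = i then 1 else 0)"
  by transfer simp

lemma cinner_ell2_basis: "cinner x (ell2_basis i) = ell2_nth x i"
proof -
  have "(\<lambda>n. ell2_nth x n * cnj (ell2_nth (ell2_basis i) n)) = (\<lambda>n. if n = i then ell2_nth x n else 0)"
    by (auto simp: ell2_nth_basis)
  then show ?thesis
    using sums_single[of i "ell2_nth x"] by (simp add: cinner_ell2_def sums_iff)
qed

lemma ell2_nth_sum: "ell2_nth (\<Sum>i\<in>I. g i) n = (\<Sum>i\<in>I. ell2_nth (g i) n)"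
  by (induction I rule: infinite_finite_induct) (simp_all add: ell2_nth_simps)

text \<open>
  The square of the distance between \<open>x\<close> and its \<open>n\<close>-th truncation is the \<open>n\<close>-th tail of the
  series for \<open>\<parallel>x\<parallel>\<^sup>2\<close>.
\<close>

lemma ell2_basis_expansion: "(\<lambda>n. \<Sum>i<n. ell2_nth x i *\<^sub>C ell2_basis i) \<longlonglongrightarrow> x"
proof -
  let ?s = "\<lambda>n. \<Sum>i<n. ell2_nth x i *\<^sub>C ell2_basis i"
  let ?f = "\<lambda>k. (cmod (ell2_nth x k))\<^sup>2"
  have "(norm (?s n - x))\<^sup>2 = suminf ?f - (\<Sum>k<n. ?f k)" for n
  proof -
    have nth: "ell2_nth (?s n) k = (if k < n then ell2_nth x k else 0)" for k
      by (simp add: ell2_nth_sum ell2_nth_simps ell2_nth_basis if_distrib cong: if_cong)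
    have fin: "(\<lambda>k. if k < n then ?f k else 0) sums (\<Sum>k<n. ?f k)"
      using sums_If_finite_set[of "{..<n}" ?f] by simp
    have "(norm (?s n - x))\<^sup>2 = (\<Sum>k. ?f k - (if k < n then ?f k else 0))"
      unfolding power2_norm_ell2 by (intro suminf_cong) (simp add: ell2_nth_simps nth)
    also have "\<dots> = suminf ?f - (\<Sum>k<n. ?f k)"
      using suminf_diff[OF ell2_summable[of x] sums_summable[OF fin]] sums_unique[OF fin] by simp
    finally show ?thesis .
  qed
  moreover have "(\<lambda>n. suminf ?f - (\<Sum>k<n. ?f k)) \<longlonglongrightarrow> suminf ?f - suminf ?f"
    by (intro tendsto_intros summable_LIMSEQ ell2_summable)
  ultimately have "(\<lambda>n. (norm (?s n - x))\<^sup>2) \<longlonglongrightarrow> 0" by simp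
  then have "(\<lambda>n. sqrt ((norm (?s n - x))\<^sup>2)) \<longlonglongrightarrow> sqrt 0"
    by (rule tendsto_real_sqrt)
  then show ?thesis by (simp add: LIM_zero_iff tendsto_norm_zero_iff)
qed

lemma bounded_clinear_eq_on_basis:
  assumes F: "bounded_clinear F" and G: "bounded_clinear G"
    and eq: "\<And>i. F (ell2_basis i) = G (ell2_basis i)"
  shows "F = G"
proof
  fix x
  let ?s = "\<lambda>n. \<Sum>i<n. ell2_nth x i *\<^sub>C ell2_basis i"
  have sum: "H (?s n) = (\<Sum>i<n. ell2_nth x i *\<^sub>C H (ell2_basis i))" if H: "bounded_clinear H" for H :: "ell2 \<Rightarrow> 'a" and n
    by (simp add: linear_sum[OF bounded_linear.linear[OF bounded_clinearD(1)[OF H]]] bounded_clinearD(2)[OF H])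
  have "(\<lambda>n. F (?s n)) \<longlonglongrightarrow> F x" "(\<lambda>n. G (?s n)) \<longlonglongrightarrow> G x"
    by (intro bounded_linear.tendsto[OF _ ell2_basis_expansion] bounded_clinearD F G)+
  moreover have "F (?s n) = G (?s n)" for n by (simp add: sum F G eq)
  ultimately show "F x = G x" by (simp add: LIMSEQ_unique)
qed

definition hilbert_schmidt :: "(ell2 \<Rightarrow> 'b::real_normed_vector) \<Rightarrow> bool" where
  "hilbert_schmidt M \<longleftrightarrow> summable (\<lambda>i. (norm (M (ell2_basis i)))\<^sup>2)"

lemma hilbert_schmidt_bound:
  assumes N: "hilbert_schmidt N" and bound: "\<And>x. norm (M x) \<le> k * norm (N x)"
  shows "hilbert_schmidt M"
  unfolding hilbert_schmidt_def
proof (rule summable_comparison_test')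
  show "summable (\<lambda>i. k\<^sup>2 * (norm (N (ell2_basis i)))\<^sup>2)"
    using N unfolding hilbert_schmidt_def by (rule summable_mult)
  fix i :: nat
  show "norm ((norm (M (ell2_basis i)))\<^sup>2) \<le> k\<^sup>2 * (norm (N (ell2_basis i)))\<^sup>2"
    using power_mono[OF bound[of "ell2_basis i"], of 2] by (simp add: power_mult_distrib)
qed

lemma hilbert_schmidt_compose_left:
  assumes "bounded_linear B" "hilbert_schmidt M"
  shows "hilbert_schmidt (\<lambda>x. B (M x))"
proof -
  obtain k where "\<And>x. norm (B x) \<le> norm x * k"
    using bounded_linear.bounded[OF assms(1)] by blast
  then show ?thesis
    by (intro hilbert_schmidt_bound[OF assms(2), of _ k]) (simp add: mult.commute)
qed

lemma hilbert_schmidt_add: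
  assumes "hilbert_schmidt M" "hilbert_schmidt N"
  shows "hilbert_schmidt (\<lambda>x. M x + N x)"
  unfolding hilbert_schmidt_def
proof (rule summable_comparison_test')
  let ?m = "\<lambda>i. norm (M (ell2_basis i))" and ?n = "\<lambda>i. norm (N (ell2_basis i))"
  show "summable (\<lambda>i. 2 * (?m i)\<^sup>2 + 2 * (?n i)\<^sup>2)"
    using assms unfolding hilbert_schmidt_def by (intro summable_add summable_mult)
  fix i :: nat
  have "(norm (M (ell2_basis i) + N (ell2_basis i)))\<^sup>2 \<le> (?m i + ?n i)\<^sup>2"
    by (intro power_mono norm_triangle_ineq) simp
  also have "\<dots> \<le> 2 * (?m i)\<^sup>2 + 2 * (?n i)\<^sup>2"
    using sum_squares_bound[of "?m i" "?n i"] by (simp add: power2_sum)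
  finally show "norm ((norm (M (ell2_basis i) + N (ell2_basis i)))\<^sup>2) \<le> 2 * (?m i)\<^sup>2 + 2 * (?n i)\<^sup>2"
    by simp
qed

lemma hilbert_schmidt_diff:
  assumes "hilbert_schmidt M" "hilbert_schmidt N"
  shows "hilbert_schmidt (\<lambda>x. M x - N x)"
  using hilbert_schmidt_add[OF assms(1), of "\<lambda>x. - N x"] assms(2) by (simp add: hilbert_schmidt_def)

text \<open>
  Both sums of squared norms are the sum of the squared moduli of all matrix entries, taken by
  rows or by columns. Together with composition on the left this makes the Hilbert--Schmidt
  operators a two-sided ideal.
\<close>

lemma hilbert_schmidt_adjoint:
  fixes M :: "ell2 \<Rightarrow> ell2"
  assumes M: "bounded_clinear M" and hs: "hilbert_schmidt M"
  shows "hilbert_schmidt (adjoint M)"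
  unfolding hilbert_schmidt_def
proof (rule summableI_nonneg_bounded)
  fix n
  let ?e = ell2_basis
  have entry: "cmod (ell2_nth (adjoint M (?e i)) j) = cmod (ell2_nth (M (?e j)) i)" for i j
    unfolding cinner_ell2_basis[symmetric] cinner_adjoint[OF M]
    by (subst cinner_commute) (simp add: complex_mod_cnj)
  have "(\<Sum>i<n. (norm (adjoint M (?e i)))\<^sup>2) = (\<Sum>i<n. \<Sum>j. (cmod (ell2_nth (adjoint M (?e i)) j))\<^sup>2)"
    by (simp add: power2_norm_ell2)
  also have "\<dots> = (\<Sum>j. \<Sum>i<n. (cmod (ell2_nth (adjoint M (?e i)) j))\<^sup>2)"
    by (rule suminf_sum[symmetric]) (rule ell2_summable)
  also have "\<dots> \<le> (\<Sum>j. (norm (M (?e j)))\<^sup>2)"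
  proof (rule suminf_le)
    show "(\<Sum>i<n. (cmod (ell2_nth (adjoint M (?e i)) j))\<^sup>2) \<le> (norm (M (?e j)))\<^sup>2" for j
      unfolding entry by (rule sum_le_power2_norm_ell2) simp
    show "summable (\<lambda>j. \<Sum>i<n. (cmod (ell2_nth (adjoint M (?e i)) j))\<^sup>2)"
      by (intro summable_sum ell2_summable)
    show "summable (\<lambda>j. (norm (M (?e j)))\<^sup>2)"
      using hs by (simp add: hilbert_schmidt_def)
  qed
  finally show "(\<Sum>i<n. (norm (adjoint M (?e i)))\<^sup>2) \<le> (\<Sum>j. (norm (M (?e j)))\<^sup>2)" .
qed simp

section \<open>Synthesis operators of frames\<close>

lemma cinner_sum_left: "cinner (\<Sum>i\<in>I. g i) y = (\<Sum>i\<in>I. cinner (g i) y)"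
proof -
  have "cinner 0 y = 0" using cinner_add_left[of 0 0 y] by simp
  then show ?thesis
    by (induction I rule: infinite_finite_induct) (simp_all add: cinner_add_left)
qed

text \<open>
  The upper frame bound controls the coefficients of \<open>g\<close>; pairing the finite sum \<open>g\<close> with itself
  turns this into control of \<open>g\<close> by its coefficients. The bound is available only for vectors
  of \<open>K\<close>, which is why \<open>g\<close> must lie there.
\<close>

lemma bessel_finite_sum:
  fixes f :: "nat \<Rightarrow> 'h::complex_inner"
  assumes K: "csubspace K" "\<And>i. f i \<in> K" and B: "0 \<le> B"
    and bessel: "\<And>g. g \<in> K \<Longrightarrow> summable (\<lambda>i. (cmod (cinner g (f i)))\<^sup>2)"
      "\<And>g. g \<in> K \<Longrightarrow> (\<Sum>i. (cmod (cinner g (f i)))\<^sup>2) \<le> B * (norm g)\<^sup>2"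
    and "finite I"
  shows "(norm (\<Sum>i\<in>I. a i *\<^sub>C f i))\<^sup>2 \<le> B * (\<Sum>i\<in>I. (cmod (a i))\<^sup>2)"
proof -
  define g where "g = (\<Sum>i\<in>I. a i *\<^sub>C f i)"
  have gK: "g \<in> K"
    unfolding g_def using K by (intro complex_vector.subspace_sum complex_vector.subspace_scale)
  have "(norm g)\<^sup>2 = cmod (cinner g g)"
    by (simp only: cinner_self norm_of_real abs_power2)
  also have "cinner g g = (\<Sum>i\<in>I. a i * cinner (f i) g)"
    by (subst (1) g_def) (simp add: cinner_sum_left cinner_scaleC_left)
  also have "cmod \<dots> \<le> (\<Sum>i\<in>I. cmod (a i) * cmod (cinner g (f i)))"
    by (intro sum_norm_le) (simp add: norm_mult cinner_commute[of g] complex_mod_cnj)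
  finally have "((norm g)\<^sup>2)\<^sup>2 \<le> (\<Sum>i\<in>I. cmod (a i) * cmod (cinner g (f i)))\<^sup>2"
    by (intro power_mono) simp_all
  also have "\<dots> \<le> (\<Sum>i\<in>I. (cmod (a i))\<^sup>2) * (\<Sum>i\<in>I. (cmod (cinner g (f i)))\<^sup>2)"
    by (rule Cauchy_Schwarz_ineq_sum)
  also have "\<dots> \<le> (\<Sum>i\<in>I. (cmod (a i))\<^sup>2) * (B * (norm g)\<^sup>2)"
  proof (rule mult_left_mono)
    show "(\<Sum>i\<in>I. (cmod (cinner g (f i)))\<^sup>2) \<le> B * (norm g)\<^sup>2"
      using sum_le_suminf[OF bessel(1)[OF gK] \<open>finite I\<close>] bessel(2)[OF gK] by simp
  qed (simp add: sum_nonneg)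
  finally have *: "(norm g)\<^sup>2 * (norm g)\<^sup>2 \<le> (B * (\<Sum>i\<in>I. (cmod (a i))\<^sup>2)) * (norm g)\<^sup>2"
    by (simp add: power2_eq_square[of "(norm g)\<^sup>2"] mult_ac)
  have "(norm g)\<^sup>2 \<le> B * (\<Sum>i\<in>I. (cmod (a i))\<^sup>2)"
  proof (cases "g = 0")
    case False
    then show ?thesis using mult_right_le_imp_le[OF *] by simp
  qed (simp add: B sum_nonneg)
  then show ?thesis by (simp only: g_def)
qed

lemma exists_synthesis_operator:
  fixes f :: "nat \<Rightarrow> 'h::complex_hilbert"
  assumes K: "closed_csubspace K" "\<And>i. f i \<in> K" and B: "0 \<le> B"
    and bessel: "\<And>g. g \<in> K \<Longrightarrow> summable (\<lambda>i. (cmod (cinner g (f i)))\<^sup>2)"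
      "\<And>g. g \<in> K \<Longrightarrow> (\<Sum>i. (cmod (cinner g (f i)))\<^sup>2) \<le> B * (norm g)\<^sup>2"
  shows "\<exists>F. bounded_clinear F \<and> (\<forall>i. F (ell2_basis i) = f i) \<and> range F \<subseteq> K"
proof -
  have sK: "csubspace K" and cK: "closed K"
    using K(1) by (auto simp: closed_csubspace_def)
  have finite_bound: "(norm (\<Sum>i\<in>I. a i *\<^sub>C f i))\<^sup>2 \<le> B * (\<Sum>i\<in>I. (cmod (a i))\<^sup>2)"
    if "finite I" for a I
    using that by (rule bessel_finite_sum[OF sK K(2) B bessel, rotated -1])
  have summ: "summable (\<lambda>i. ell2_nth a i *\<^sub>C f i)" for a
    unfolding summable_Cauchy
  proof (intro allI impI)
    fix e :: real assume e: "0 < e"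
    then have "0 < e\<^sup>2 / (B + 1)" using B by simp
    then obtain N where N: "\<And>m n. m \<ge> N \<Longrightarrow> norm (\<Sum>i=m..<n. (cmod (ell2_nth a i))\<^sup>2) < e\<^sup>2 / (B + 1)"
      using ell2_summable[of a] unfolding summable_Cauchy by blast
    have "norm (\<Sum>i=m..<n. ell2_nth a i *\<^sub>C f i) < e" if "m \<ge> N" for m n
    proof (rule power2_less_imp_less)
      let ?s = "\<Sum>i=m..<n. (cmod (ell2_nth a i))\<^sup>2"
      have s: "0 \<le> ?s" by (simp add: sum_nonneg)
      then have "?s < e\<^sup>2 / (B + 1)" using N[OF that, of n] by simp
      then have "(B + 1) * ?s < e\<^sup>2" using B by (simp add: field_simps)
      moreover have "(norm (\<Sum>i=m..<n. ell2_nth a i *\<^sub>C f i))\<^sup>2 \<le> B * ?s"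
        by (rule finite_bound) simp
      ultimately show "(norm (\<Sum>i=m..<n. ell2_nth a i *\<^sub>C f i))\<^sup>2 < e\<^sup>2"
        using s by (simp add: distrib_right)
    qed (use e in simp)
    then show "\<exists>N. \<forall>m\<ge>N. \<forall>n. norm (\<Sum>i=m..<n. ell2_nth a i *\<^sub>C f i) < e" by blast
  qed
  define F where "F a = (\<Sum>i. ell2_nth a i *\<^sub>C f i)" for a
  have F_lim: "(\<lambda>n. \<Sum>i<n. ell2_nth a i *\<^sub>C f i) \<longlonglongrightarrow> F a" for a
    unfolding F_def by (rule summable_LIMSEQ[OF summ])
  have scale: "F (c *\<^sub>C a) = c *\<^sub>C F a" for c a
    using bounded_linear.suminf[OF bounded_linear_scaleC summ[of a], of c]
    by (simp add: F_def ell2_nth_simps scaleC_scaleC)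
  have bound: "norm (F a) \<le> norm a * sqrt B" for a
  proof (rule LIMSEQ_le_const2[OF tendsto_norm[OF F_lim]], intro exI allI impI)
    fix n :: nat
    have "(norm (\<Sum>i<n. ell2_nth a i *\<^sub>C f i))\<^sup>2 \<le> B * (\<Sum>i<n. (cmod (ell2_nth a i))\<^sup>2)"
      by (rule finite_bound) simp
    also have "\<dots> \<le> B * (norm a)\<^sup>2"
      using B by (intro mult_left_mono sum_le_power2_norm_ell2) auto
    also have "\<dots> = (norm a * sqrt B)\<^sup>2" using B by (simp add: power_mult_distrib)
    finally show "norm (\<Sum>i<n. ell2_nth a i *\<^sub>C f i) \<le> norm a * sqrt B"
      by (rule power2_le_imp_le) (use B in simp)
  qed
  have "bounded_linear F"
  proof (rule bounded_linear_intro[OF _ _ bound])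
    show "F (a + b) = F a + F b" for a b
      unfolding F_def suminf_add[OF summ summ]
      by (simp add: ell2_nth_simps scaleC_add_left)
    show "F (r *\<^sub>R a) = r *\<^sub>R F a" for r a
      using scale[of "complex_of_real r" a] by (simp add: scaleC_of_real)
  qed
  then have "bounded_clinear F" by (simp add: bounded_clinear_def scale)
  moreover have "F (ell2_basis i) = f i" for i
  proof -
    have "(\<lambda>n. ell2_nth (ell2_basis i) n *\<^sub>C f n) = (\<lambda>n. if n = i then f n else 0)"
      by (auto simp: ell2_nth_basis)
    then show ?thesis using sums_single[of i f] by (simp add: F_def sums_iff)
  qed
  moreover have "F a \<in> K" for a
    using cK _ F_lim
    by (rule closed_sequentially) (intro complex_vector.subspace_sum complex_vector.subspace_scale sK K(2))
  ultimately show ?thesis by blast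
qed

lemma synthesis_operator_eqI:
  assumes "bounded_clinear F" "\<And>i. F (ell2_basis i) = f i"
  shows "synthesis_operator f = F"
  unfolding synthesis_operator_def
  using assms by (intro the_equality) (auto intro: bounded_clinear_eq_on_basis)

text \<open>
  The adjoint of a synthesis operator sends \<open>g\<close> to the sequence of its frame coefficients.
\<close>

lemma analysis_operator:
  fixes F :: "ell2 \<Rightarrow> 'h::complex_inner"
  assumes F: "bounded_clinear F"
  shows "summable (\<lambda>i. (cmod (cinner g (F (ell2_basis i))))\<^sup>2)"
    and "(\<Sum>i. (cmod (cinner g (F (ell2_basis i))))\<^sup>2) = (norm (adjoint F g))\<^sup>2"
proof -
  have "cinner g (F (ell2_basis i)) = ell2_nth (adjoint F g) i" for i
    by (metis cinner_adjoint[OF F] cinner_commute cinner_ell2_basis)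
  then show "summable (\<lambda>i. (cmod (cinner g (F (ell2_basis i))))\<^sup>2)"
    "(\<Sum>i. (cmod (cinner g (F (ell2_basis i))))\<^sup>2) = (norm (adjoint F g))\<^sup>2"
    by (simp_all add: ell2_summable power2_norm_ell2)
qed

text \<open>
  The frame inequalities, read through the analysis operator, bound the adjoint of the synthesis
  operator above and below on \<open>K\<close>.
\<close>

lemma frame_synthesis:
  fixes f :: "nat \<Rightarrow> 'h::complex_hilbert"
  assumes K: "closed_csubspace K" "\<And>i. f i \<in> K" and fb: "frame_bounds K f A B" and B: "0 \<le> B"
  obtains F where "bounded_clinear F" "\<And>i. F (ell2_basis i) = f i" "range F \<subseteq> K"
    "\<And>g. g \<in> K \<Longrightarrow> A * (norm g)\<^sup>2 \<le> (norm (adjoint F g))\<^sup>2"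
    "\<And>g. g \<in> K \<Longrightarrow> (norm (adjoint F g))\<^sup>2 \<le> B * (norm g)\<^sup>2"
proof -
  obtain F where F: "bounded_clinear F" "\<And>i. F (ell2_basis i) = f i" "range F \<subseteq> K"
    using exists_synthesis_operator[where f=f, OF K B] fb unfolding frame_bounds_def by blast
  show thesis
    using that[OF F] fb analysis_operator(2)[OF F(1)] by (simp add: frame_bounds_def F(2))
qed

text \<open>
  For a Parseval frame the adjoint of the synthesis operator \<open>X\<close> is isometric on the range of \<open>X\<close>.
  The conclusion, which characterizes partial isometries, makes \<open>X\<^sup>* X\<close> idempotent.
\<close>

lemma parseval_synthesis:
  fixes X :: "ell2 \<Rightarrow> 'h::complex_hilbert"
  assumes X: "bounded_linear X" and iso: "\<And>a. norm (adjoint X (X a)) = norm (X a)"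
  shows "X (adjoint X (X a)) = X a"
proof (rule contraction_inverts_isometric_part[where G="adjoint X", OF inner_adjoint_left[OF X] _ iso])
  show "norm (X y) \<le> norm y" for y
  proof (cases "X y = 0")
    case False
    have "norm (X y) * norm (X y) = inner y (adjoint X (X y))"
      by (simp add: power2_norm_eq_inner inner_adjoint[OF X, symmetric] flip: power2_eq_square)
    also have "\<dots> \<le> norm y * norm (X y)"
      using norm_cauchy_schwarz[of y "adjoint X (X y)"] by (simp add: iso)
    finally show ?thesis using False by simp
  qed simp
qed

section \<open>Parseval frames near a given frame\<close>

text \<open>
  The range of \<open>U\<close> is the fixed space of \<open>U U\<^sup>*\<close>, which is visibly closed, and on which \<open>U\<^sup>*\<close> is
  isometric.
\<close>

lemma partial_isometry_parseval_frame:
  fixes U :: "ell2 \<Rightarrow> 'h::complex_hilbert"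
  assumes U: "partial_isometry U"
  obtains L where "closed_csubspace L" "parseval_frame_in L (\<lambda>i. U (ell2_basis i))"
proof -
  have cU: "bounded_clinear U" and bU: "bounded_linear U"
    using U by (auto simp: partial_isometry_def bounded_clinear_def)
  define Q where "Q g = U (adjoint U g)" for g
  have Q: "bounded_clinear Q"
    unfolding Q_def by (rule bounded_clinear_compose[OF cU bounded_clinear_adjoint[OF cU]])
  define L where "L = {g. Q g = g}"
  have "closed L"
    unfolding L_def
    by (intro closed_Collect_eq linear_continuous_on bounded_clinearD Q continuous_on_id)
  moreover have "csubspace L"
    by (auto simp: complex_vector.subspace_def L_def bounded_clinearD(2)[OF Q] linear_simps[OF bounded_clinearD(1)[OF Q]])
  ultimately have "closed_csubspace L" by (simp add: closed_csubspace_def)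
  moreover have "parseval_frame_in L (\<lambda>i. U (ell2_basis i))"
    unfolding parseval_frame_in_def frame_bounds_def analysis_operator(2)[OF cU]
  proof (intro conjI allI ballI analysis_operator(1)[OF cU])
    show "U (ell2_basis i) \<in> L" for i
      by (simp add: L_def Q_def partial_isometry_adjoint[OF U])
    fix g assume "g \<in> L"
    then have "(norm (adjoint U g))\<^sup>2 = (norm g)\<^sup>2"
      unfolding power2_norm_eq_inner by (simp add: L_def Q_def inner_adjoint[OF bU, symmetric])
    then show "1 * (norm g)\<^sup>2 \<le> (norm (adjoint U g))\<^sup>2" "(norm (adjoint U g))\<^sup>2 \<le> 1 * (norm g)\<^sup>2"
      by simp_all
  qed
  ultimately show thesis by (rule that)
qed

text \<open>
  If some partial isometry \<open>X\<close> differs from \<open>F\<close> by a Hilbert--Schmidt operator, then so does the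
  polar part of \<open>F\<close>: below, \<open>T = F\<^sup>* F\<close> is first compared with the idempotent \<open>Q = X\<^sup>* X\<close>, then with
  \<open>T\<^sup>2\<close>, then with the support projection \<open>P\<close>, and \<open>|F|\<close> inherits the last comparison.
\<close>

lemma hilbert_schmidt_polar_isometry:
  fixes F X :: "ell2 \<Rightarrow> 'h::complex_hilbert"
  assumes F: "bounded_clinear F" and c: "0 < c"
    and below: "\<And>x. c * norm (support_projection F x) \<le> norm (F x)"
    and X: "bounded_clinear X" "\<And>x. X (adjoint X (X x)) = X x"
    and hs: "hilbert_schmidt (\<lambda>x. F x - X x)"
  shows "hilbert_schmidt (\<lambda>x. F x - polar_isometry F x)"
proof -
  have bF: "bounded_linear F" and bX: "bounded_linear X"
    using F X(1) by (auto dest: bounded_clinearD)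
  define P where "P = support_projection F"
  define T where "T x = adjoint F (F x)" for x
  define Q where "Q x = adjoint X (X x)" for x
  define E where "E x = T x - Q x" for x
  have cT: "bounded_clinear T"
    unfolding T_def by (rule bounded_clinear_compose[OF bounded_clinear_adjoint[OF F] F])
  have cQ: "bounded_clinear Q"
    unfolding Q_def by (rule bounded_clinear_compose[OF bounded_clinear_adjoint[OF X(1)] X(1)])
  have bT: "bounded_linear T" and bQ: "bounded_linear Q"
    using cT cQ by (auto dest: bounded_clinearD)
  have T: "inner (T x) y = inner (F x) (F y)" for x y
    by (simp add: T_def inner_adjoint_left[OF bF])
  have Q: "inner (Q x) y = inner (X x) (X y)" for x y
    by (simp add: Q_def inner_adjoint_left[OF bX])
  have T_inner: "inner (T x) y = inner x (T y)" for x y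
    by (simp add: T_def inner_adjoint_left[OF bF] flip: inner_adjoint[OF bF])
  have Q_inner: "inner (Q x) y = inner x (Q y)" for x y
    by (simp add: Q_def inner_adjoint_left[OF bX] flip: inner_adjoint[OF bX])
  have D: "bounded_clinear (\<lambda>x. F x - X x)"
    by (intro bounded_clinear_diff F X(1))
  (* E = F* (F - X) + (F - X)* X, and the second summand is the adjoint of X* (F - X) *)
  have "hilbert_schmidt E"
  proof -
    have "hilbert_schmidt (\<lambda>x. adjoint F (F x - X x))"
      by (rule hilbert_schmidt_compose_left[OF bounded_linear_adjoint[OF bF] hs])
    moreover have "hilbert_schmidt (\<lambda>x. adjoint F (X x) - adjoint X (X x))"
    proof -
      let ?M = "\<lambda>x. adjoint X (F x - X x)"
      have "hilbert_schmidt ?M"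
        by (rule hilbert_schmidt_compose_left[OF bounded_linear_adjoint[OF bX] hs])
      then have "hilbert_schmidt (adjoint ?M)"
        by (rule hilbert_schmidt_adjoint[OF bounded_clinear_compose[OF bounded_clinear_adjoint[OF X(1)] D]])
      also have "adjoint ?M = (\<lambda>x. adjoint F (X x) - adjoint X (X x))"
        by (rule adjoint_unique)
          (simp add: inner_adjoint_left[OF bX] inner_diff_left inner_diff_right
            flip: inner_adjoint[OF bF] inner_adjoint[OF bX])
      finally show ?thesis .
    qed
    ultimately have "hilbert_schmidt (\<lambda>x. adjoint F (F x - X x) + (adjoint F (X x) - adjoint X (X x)))"
      by (rule hilbert_schmidt_add)
    then show ?thesis
      by (simp add: E_def[abs_def] T_def Q_def linear_simps[OF bounded_linear_adjoint[OF bF]])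
  qed
  (* E T is the adjoint of T E, because both factors are selfadjoint *)
  have "hilbert_schmidt (\<lambda>x. E (T x))"
  proof -
    have E: "inner (E x) y = inner x (E y)" for x y
      by (simp add: E_def inner_diff_left inner_diff_right T_inner Q_inner)
    have cE: "bounded_clinear E"
      unfolding E_def[abs_def] by (intro bounded_clinear_diff cT cQ)
    have "hilbert_schmidt (adjoint (\<lambda>x. T (E x)))"
      by (rule hilbert_schmidt_adjoint[OF bounded_clinear_compose[OF cT cE]
            hilbert_schmidt_compose_left[OF bT \<open>hilbert_schmidt E\<close>]])
    also have "adjoint (\<lambda>x. T (E x)) = (\<lambda>x. E (T x))"
      by (rule adjoint_unique) (simp add: T_inner E)
    finally show ?thesis .
  qed
  then have "hilbert_schmidt (\<lambda>x. E x - Q (E x) - E (T x))"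
    by (rule hilbert_schmidt_diff[OF hilbert_schmidt_diff[OF \<open>hilbert_schmidt E\<close>
            hilbert_schmidt_compose_left[OF bQ \<open>hilbert_schmidt E\<close>]]])
  (* Q is idempotent, so the defect T - T^2 is a combination of multiples of T - Q *)
  moreover have "E x - Q (E x) - E (T x) = T x - T (T x)" for x
  proof -
    have "Q (Q x) = Q x" by (simp add: Q_def X(2))
    then show ?thesis by (simp add: E_def linear_simps[OF bQ])
  qed
  ultimately have hsT: "hilbert_schmidt (\<lambda>x. T x - T (T x))" by simp

  have PT: "P (T x) = T x" for x
    unfolding P_def by (rule support_projection_eq_self[OF bF]) (simp add: T)
  have FP: "F (P x) = F x" for x
    unfolding P_def by (rule apply_support_projection[OF bF])
  have TP: "T (P x) = T x" for x by (simp add: T_def FP)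
  have bP: "bounded_linear P"
    unfolding P_def by (rule bounded_linear_support_projection[OF bF])
  (* T - T^2 = T (P - T), and T is bounded below by c^2 on the support *)
  have "hilbert_schmidt (\<lambda>x. P x - T x)"
  proof (rule hilbert_schmidt_bound[OF hsT])
    fix x
    define y where "y = P x - T x"
    have "P y = y"
      by (simp add: y_def linear_simps[OF bP] PT) (simp add: P_def support_projection_idem[OF bF])
    then have "c * norm y \<le> norm (F y)"
      using below[of y] by (simp add: P_def)
    then have "(c * norm y)\<^sup>2 \<le> (norm (F y))\<^sup>2" using c by (intro power_mono) auto
    also have "\<dots> = inner (T y) y" by (simp add: T power2_norm_eq_inner)
    also have "\<dots> \<le> norm (T y) * norm y" by (rule norm_cauchy_schwarz)
    finally have "c\<^sup>2 * norm y * norm y \<le> norm (T y) * norm y"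
      by (simp add: power2_eq_square mult_ac)
    then have "c\<^sup>2 * norm y \<le> norm (T y)" by (cases "y = 0") auto
    moreover have "T y = T x - T (T x)" by (simp add: y_def linear_simps[OF bT] TP)
    ultimately have "c\<^sup>2 * norm y \<le> norm (T x - T (T x))" by simp
    then show "norm (P x - T x) \<le> 1 / c\<^sup>2 * norm (T x - T (T x))"
      using c by (simp add: y_def[symmetric] field_simps)
  qed
  then show ?thesis
  proof (rule hilbert_schmidt_bound)
    fix x
    note polar = F c below
    let ?A = "abs_operator F" and ?U = "polar_isometry F"
    have A: "bounded_linear ?A" "selfadjoint ?A" "\<And>x. 0 \<le> inner (?A x) x"
      using positive_abs_operator[OF polar] by (auto simp: positive_operator_iff bounded_clinear_def)
    have AA: "?A (?A x) = T x" for x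
      unfolding T_def by (rule abs_operator_square[OF polar])
    have U: "partial_isometry ?U" by (rule partial_isometry_polar_isometry[OF polar])
    then have bU: "bounded_linear ?U" by (auto simp: partial_isometry_def bounded_clinear_def)
    have "F (x - P x) = 0" by (simp add: linear_simps[OF bF] FP)
    then have "inner (?A (x - P x)) (?A (x - P x)) = 0"
      by (simp add: selfadjointD[OF A(2)] AA T_def linear_simps[OF bounded_linear_adjoint[OF bF]])
    then have AP: "?A (P x) = ?A x" by (simp add: linear_simps[OF A(1)])
    have "x - P x \<in> kernel ?U"
      unfolding kernel_polar_isometry[OF polar] using \<open>F (x - P x) = 0\<close> by (simp add: kernel_def)
    then have UP: "?U (P x) = ?U x" by (simp add: kernel_def linear_simps[OF bU])
    (* F - U = U (|F| - P) and T - P = (1 + |F|) (|F| - P), where 1 + |F| does not decrease norms *)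
    define y where "y = ?A x - P x"
    have "norm (F x - ?U x) = norm (?U y)"
      by (simp add: y_def linear_simps[OF bU] polar_isometry_abs_operator[OF polar] UP)
    also have "\<dots> \<le> norm y"
      by (simp add: norm_partial_isometry[OF U] norm_support_projection_le[OF bU])
    also have "\<dots> \<le> norm (y + ?A y)"
    proof (rule power2_le_imp_le)
      have "(norm (y + ?A y))\<^sup>2 = (norm y)\<^sup>2 + 2 * inner (?A y) y + (norm (?A y))\<^sup>2"
        by (simp add: power2_norm_eq_inner inner_add inner_commute[of y "?A y"])
      then show "(norm y)\<^sup>2 \<le> (norm (y + ?A y))\<^sup>2" using A(3)[of y] by simp
    qed simp
    also have "y + ?A y = T x - P x"
      by (simp add: y_def linear_simps[OF A(1)] AA AP)
    finally show "norm (F x - ?U x) \<le> 1 * norm (P x - T x)"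
      by (simp add: norm_minus_commute)
  qed
qed

theorem theorem2p1:
  fixes f :: "nat \<Rightarrow> 'h::complex_hilbert" and K :: "'h set"
  assumes "separable_space (euclidean :: 'h topology)"
    and "\<not> (\<exists>B :: 'h set. finite B \<and> cspan B = UNIV)"
    and "closed_csubspace K"
    and "frame_in K f"
  shows "(\<exists>(L :: 'h set) (x :: nat \<Rightarrow> 'h). closed_csubspace L \<and> parseval_frame_in L x \<and>
            summable (\<lambda>i. (norm (f i - x i))\<^sup>2))
    \<longleftrightarrow> summable (\<lambda>i. (norm (f i - canonical_parseval_frame f i))\<^sup>2)"
proof -
  obtain A B where AB: "0 < A" "0 < B" "frame_bounds K f A B" and fK: "\<And>i. f i \<in> K"
    using assms(4) by (auto simp: frame_in_def)
  obtain F where F: "bounded_clinear F" "\<And>i. F (ell2_basis i) = f i" "range F \<subseteq> K"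
    and lower: "\<And>g. g \<in> K \<Longrightarrow> A * (norm g)\<^sup>2 \<le> (norm (adjoint F g))\<^sup>2"
    by (rule frame_synthesis[OF assms(3) fK AB(3) less_imp_le[OF AB(2)]]) (rule that)
  have synth: "synthesis_operator f = F" by (rule synthesis_operator_eqI[OF F(1,2)])
  define c where "c = sqrt A"
  have c: "0 < c" using AB(1) by (simp add: c_def)
  have "c * norm (F x) \<le> norm (adjoint F (F x))" for x
  proof (rule power2_le_imp_le)
    show "(c * norm (F x))\<^sup>2 \<le> (norm (adjoint F (F x)))\<^sup>2"
      using lower[of "F x"] F(3) AB(1) by (auto simp: c_def power_mult_distrib)
  qed simp
  then have below: "c * norm (support_projection F x) \<le> norm (F x)" for x
    by (rule bounded_below_on_support[OF bounded_clinearD(1)[OF F(1)] c])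
  define U where "U = polar_isometry F"
  have U: "partial_isometry U"
    unfolding U_def by (rule partial_isometry_polar_isometry[OF F(1) c below])
  have canonical: "canonical_parseval_frame f = (\<lambda>i. U (ell2_basis i))"
    by (simp add: canonical_parseval_frame_def[abs_def] synth U_def)
  show ?thesis
  proof
    assume "summable (\<lambda>i. (norm (f i - canonical_parseval_frame f i))\<^sup>2)"
    moreover obtain L where "closed_csubspace L" "parseval_frame_in L (canonical_parseval_frame f)"
      unfolding canonical by (rule partial_isometry_parseval_frame[OF U])
    ultimately show "\<exists>(L :: 'h set) (x :: nat \<Rightarrow> 'h). closed_csubspace L \<and> parseval_frame_in L x \<and>
            summable (\<lambda>i. (norm (f i - x i))\<^sup>2)"
      by blast
  next
    assume "\<exists>(L :: 'h set) (x :: nat \<Rightarrow> 'h). closed_csubspace L \<and> parseval_frame_in L x \<and>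
            summable (\<lambda>i. (norm (f i - x i))\<^sup>2)"
    then obtain L and x :: "nat \<Rightarrow> 'h" where L: "closed_csubspace L" "\<And>i. x i \<in> L" "frame_bounds L x 1 1"
      and close: "summable (\<lambda>i. (norm (f i - x i))\<^sup>2)"
      by (auto simp: parseval_frame_in_def)
    obtain X where X: "bounded_clinear X" "\<And>i. X (ell2_basis i) = x i" "range X \<subseteq> L"
      and iso: "\<And>g. g \<in> L \<Longrightarrow> 1 * (norm g)\<^sup>2 \<le> (norm (adjoint X g))\<^sup>2"
        "\<And>g. g \<in> L \<Longrightarrow> (norm (adjoint X g))\<^sup>2 \<le> 1 * (norm g)\<^sup>2"
      by (rule frame_synthesis[OF L zero_le_one]) (rule that)
    have "norm (adjoint X (X a)) = norm (X a)" for a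
    proof -
      have "(norm (adjoint X (X a)))\<^sup>2 = (norm (X a))\<^sup>2"
        using iso[of "X a"] X(3) by (intro antisym) auto
      then show ?thesis by simp
    qed
    then have "X (adjoint X (X a)) = X a" for a
      by (rule parseval_synthesis[OF bounded_clinearD(1)[OF X(1)]])
    then have "hilbert_schmidt (\<lambda>a. F a - U a)"
      unfolding U_def using close
      by (intro hilbert_schmidt_polar_isometry[OF F(1) c below X(1)]) (simp_all add: hilbert_schmidt_def F(2) X(2))
    then show "summable (\<lambda>i. (norm (f i - canonical_parseval_frame f i))\<^sup>2)"
      by (simp add: hilbert_schmidt_def canonical F(2))
  qed
qed

end
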